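(* Let $\mathrm{DC}_k$ denote the double circle with $k$ external and $k$ internal points, and let $|\mathfrak{T}(\mathrm{DC}_k)|$ be its number of triangulations. Then, as $k\to\infty$, \[ |\mathfrak{T}(\mathrm{DC}_k)| \sim \frac{54}{7\sqrt{\pi}}\,\frac{\sqrt{21}\,(5-\sqrt{21})}{(7-\sqrt{21})^2}\,12^{k-2}\,k^{-3/2}. \]
   Context: The double circle $\mathrm{DC}_k$ is the planar point set of $2k$ points consisting of the $k$ vertices $p_1,\dots,p_k$ of a convex $k$-gon together with, for each edge $p_ip_{i+1}$ (indices mod $k$), one point $q_i$ placed inside the polygon very close to the midpoint of that edge (close enough that the orientations of all triples of points, and hence everything below, do not depend on the exact placement). All point sets are in general position (no three collinear). A triangulation of a finite planar point set in general position is an inclusion-maximal set of segments with endpoints in the set such that no two segments cross (segments sharing an endpoint are not considered crossing). *)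

theory Defs
  imports "HOL-Analysis.Analysis" "HOL-Library.Landau_Symbols"
begin

type_synonym point = "real \<times> real"

definition segments :: "point set \<Rightarrow> point set set" where
  "segments S = {{a, b} | a b. a \<in> S \<and> b \<in> S \<and> a \<noteq> b}"

definition crosses :: "point set \<Rightarrow> point set \<Rightarrow> bool" where
  "crosses e f \<longleftrightarrow> e \<inter> f = {} \<and> convex hull e \<inter> convex hull f \<noteq> {}"

definition triangulation :: "point set \<Rightarrow> point set set \<Rightarrow> bool" where
  "triangulation S T \<longleftrightarrow>
     T \<subseteq> segments S \<and>
     (\<forall>e\<in>T. \<forall>f\<in>T. \<not> crosses e f) \<and>
     (\<forall>e\<in>segments S - T. \<exists>f\<in>T. crosses e f)"

definition triangulations :: "point set \<Rightarrow> point set set set" where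
  "triangulations S = {T. triangulation S T}"

text \<open>Outer points: vertices of the regular k-gon (indices mod k automatically,
  by periodicity of cos/sin).\<close>
definition dc_outer :: "nat \<Rightarrow> nat \<Rightarrow> point" where
  "dc_outer k i = (cos (2 * pi * real i / real k), sin (2 * pi * real i / real k))"

definition dc_inner :: "nat \<Rightarrow> real \<Rightarrow> nat \<Rightarrow> point" where
  "dc_inner k eps i = (1 - eps) *\<^sub>R midpoint (dc_outer k i) (dc_outer k (Suc i))"

definition double_circle :: "nat \<Rightarrow> real \<Rightarrow> point set" where
  "double_circle k eps = dc_outer k ` {..<k} \<union> dc_inner k eps ` {..<k}"

definition num_tri_DC :: "nat \<Rightarrow> nat" where
  "num_tri_DC k = (THE n. eventually (\<lambda>eps. card (triangulations (double_circle k eps)) = n)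
                                      (at_right 0))"

end

theory Submission
  imports Defs "HOL-Probability.Distributions" "HOL-Real_Asymp.Real_Asymp"
begin

text \<open>List the points of the double circle in cyclic order \<open>p\<^sub>0, q\<^sub>0, p\<^sub>1, q\<^sub>1, \<dots>\<close>.  Two segments cross
  exactly as in a convex \<open>2 k\<close>-gon, except that the hull edges \<open>p\<^sub>i p\<^sub>i\<^sub>+\<^sub>1\<close> cross nothing.  Hence triangulations
  of the double circle correspond to triangulations of a convex \<open>2 k\<close>-gon in which no ear is cut off at any
  of the \<open>k\<close> vertices \<open>q\<^sub>i\<close>.  Since the Catalan numbers are the moments
  \<open>C\<^sub>m = 4/\<pi> \<integral> x\<^sup>m sin\<^sup>2 t dt\<close> with \<open>x = 4 cos\<^sup>2 t\<close> over \<open>[0, \<pi>/2]\<close>, forbidding an ear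
  amounts to replacing one factor \<open>x\<close> by \<open>x - 1\<close>, and the number of triangulations is
  \<open>4/\<pi> \<integral> x\<^sup>k\<^sup>-\<^sup>2 (x - 1)\<^sup>k sin\<^sup>2 t dt\<close>.  Laplace's method at \<open>t = 0\<close>, where \<open>x (x - 1) = 12\<close>, gives
  the asymptotics.\<close>

subsection \<open>Triangulations of the ear-free polygon\<close>

text \<open>Two obstacles shape the argument. First, ears are struck from the available chords, so a
  maximal crossing-free set might leave a face that is not a triangle;
  \<open>dissections_apex\<close> excludes this and yields a recurrence over the apex of the
  triangle on a root chord. Second, no ear is ever cut off from an actual triangulation: the moments
  are shown to obey the same recurrence as the counts. That proof needs an unmarked inner vertex;
  with alternating marks it is lacking only when a single marked vertex remains, and there both
  numbers are 0. The polygon is cut open at the side \<open>(0, 2 k - 1)\<close>, so the ear at the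
  last vertex falls outside the linear order and is corrected at the end. In the geometry,
  \<open>eps = 0\<close> is degenerate only at the triples \<open>p_i, q_i, p_(i+1)\<close>; all
  other orientations are settled there and persist by continuity. For the rate,
  \<open>cos^2 t\<close> and \<open>(4 cos^2 t - 1) / 3 = 1 - 4/3 sin^2 t\<close> have second-order
  coefficients -1 and -4/3, hence the Gaussian parameter 7/3; the factor \<open>sin^2 t\<close>
  makes it a second moment and gives the power -3/2 of \<open>k\<close>.\<close>

definition maximal_independent :: "'a set \<Rightarrow> ('a \<Rightarrow> 'a \<Rightarrow> bool) \<Rightarrow> 'a set set" where
  "maximal_independent U R =
    {T. T \<subseteq> U \<and> (\<forall>e\<in>T. \<forall>f\<in>T. \<not> R e f) \<and> (\<forall>e\<in>U - T. \<exists>f\<in>T. R e f)}"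

lemma triangulations_eq_maximal_independent:
  "triangulations S = maximal_independent (segments S) crosses"
  by (simp add: triangulations_def triangulation_def maximal_independent_def)

lemma finite_maximal_independent: "finite U \<Longrightarrow> finite (maximal_independent U R)"
  by (rule finite_subset[of _ "Pow U"]) (auto simp: maximal_independent_def)

lemma maximal_independent_cong:
  assumes "\<And>e f. e \<in> U \<Longrightarrow> f \<in> U \<Longrightarrow> R e f \<longleftrightarrow> R' e f"
  shows "maximal_independent U R = maximal_independent U R'"
proof -
  have "(T \<in> maximal_independent U R) = (T \<in> maximal_independent U R')" for T
  proof (cases "T \<subseteq> U")
    case True
    have 1: "R e f \<longleftrightarrow> R' e f" if "e \<in> T" "f \<in> T" for e f
      using True assms that by blast
    have 2: "R e f \<longleftrightarrow> R' e f" if "e \<in> U - T" "f \<in> T" for e f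
      using True assms that by blast
    show ?thesis unfolding maximal_independent_def using 1 2 by auto
  qed (auto simp: maximal_independent_def)
  then show ?thesis by blast
qed

lemma card_maximal_independent_image:
  assumes "inj_on E U"
  shows "card (maximal_independent (E ` U) R) = card (maximal_independent U (\<lambda>e f. R (E e) (E f)))"
proof -
  have mem: "E x \<in> E ` T \<longleftrightarrow> x \<in> T" if "x \<in> U" "T \<subseteq> U" for x T
    using assms that by (auto dest: inj_onD)
  have iff: "E ` T \<in> maximal_independent (E ` U) R \<longleftrightarrow>
      T \<in> maximal_independent U (\<lambda>e f. R (E e) (E f))" if "T \<subseteq> U" for T
    using that mem by (auto simp: maximal_independent_def)
  have "bij_betw ((`) E) (maximal_independent U (\<lambda>e f. R (E e) (E f)))
      (maximal_independent (E ` U) R)"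
  proof (rule bij_betw_imageI)
    show "inj_on ((`) E) (maximal_independent U (\<lambda>e f. R (E e) (E f)))"
      using inj_on_image_Pow[OF assms]
      by (rule inj_on_subset) (auto simp: maximal_independent_def)
    show "(`) E ` maximal_independent U (\<lambda>e f. R (E e) (E f)) = maximal_independent (E ` U) R"
    proof (intro equalityI subsetI)
      fix T assume T: "T \<in> maximal_independent (E ` U) R"
      then have "T \<subseteq> E ` U" by (simp add: maximal_independent_def)
      then obtain T' where "T' \<subseteq> U" "T = E ` T'" by (auto simp: subset_image_iff)
      with T iff show "T \<in> (`) E ` maximal_independent U (\<lambda>e f. R (E e) (E f))" by blast
    next
      fix T assume "T \<in> (`) E ` maximal_independent U (\<lambda>e f. R (E e) (E f))"
      then obtain T' where T': "T' \<in> maximal_independent U (\<lambda>e f. R (E e) (E f))" "T = E ` T'"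
        by blast
      moreover have "T' \<subseteq> U" using T' by (simp add: maximal_independent_def)
      ultimately show "T \<in> maximal_independent (E ` U) R" using iff by blast
    qed
  qed
  then show ?thesis by (simp add: bij_betw_same_card)
qed

lemma card_maximal_independent_Diff_isolated:
  assumes Z: "Z \<subseteq> U" and iso: "\<And>e f. e \<in> Z \<Longrightarrow> f \<in> U \<Longrightarrow> \<not> R e f \<and> \<not> R f e"
  shows "card (maximal_independent U R) = card (maximal_independent (U - Z) R)"
proof -
  have "bij_betw (\<lambda>T. T - Z) (maximal_independent U R) (maximal_independent (U - Z) R)"
  proof (rule bij_betwI[where g = "\<lambda>T. T \<union> Z"])
    show "(\<lambda>T. T - Z) \<in> maximal_independent U R \<rightarrow> maximal_independent (U - Z) R"
    proof
      fix T assume T: "T \<in> maximal_independent U R"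
      have "\<exists>f\<in>T - Z. R e f" if e: "e \<in> U - Z - (T - Z)" for e
      proof -
        obtain f where f: "f \<in> T" "R e f" using T e unfolding maximal_independent_def by blast
        with iso e have "f \<notin> Z" by blast
        with f show ?thesis by blast
      qed
      with T show "T - Z \<in> maximal_independent (U - Z) R"
        unfolding maximal_independent_def by blast
    qed
    show "(\<lambda>T. T \<union> Z) \<in> maximal_independent (U - Z) R \<rightarrow> maximal_independent U R"
    proof
      fix T assume "T \<in> maximal_independent (U - Z) R"
      then have T: "T \<subseteq> U - Z" "\<forall>e\<in>T. \<forall>f\<in>T. \<not> R e f"
          "\<forall>e\<in>U - Z - T. \<exists>f\<in>T. R e f"
        by (auto simp: maximal_independent_def)
      have "\<not> R e f" if "e \<in> T \<union> Z" "f \<in> T \<union> Z" for e f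
      proof (cases "e \<in> T \<and> f \<in> T")
        case False
        with that have "e \<in> Z \<and> f \<in> U \<or> e \<in> U \<and> f \<in> Z" using T(1) Z by blast
        then show ?thesis using iso by blast
      qed (use T in blast)
      moreover have "\<exists>f\<in>T \<union> Z. R e f" if "e \<in> U - (T \<union> Z)" for e using T(3) that by blast
      ultimately show "T \<union> Z \<in> maximal_independent U R"
        using T(1) Z unfolding maximal_independent_def by blast
    qed
    show "T - Z \<union> Z = T" if T: "T \<in> maximal_independent U R" for T
    proof -
      have "e \<in> T" if "e \<in> Z" for e
      proof (rule ccontr)
        assume "e \<notin> T"
        with T that Z obtain f where "f \<in> T" "R e f" unfolding maximal_independent_def by blast
        with T iso[OF that] show False unfolding maximal_independent_def by blast
      qed
      then show ?thesis by blast
    qed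
    show "T \<union> Z - Z = T" if "T \<in> maximal_independent (U - Z) R" for T
      using that by (auto simp: maximal_independent_def)
  qed
  then show ?thesis by (rule bij_betw_same_card)
qed

section \<open>Dissections of an interval of vertices\<close>

definition interleave :: "nat \<times> nat \<Rightarrow> nat \<times> nat \<Rightarrow> bool" where
  "interleave e f \<longleftrightarrow>
    fst e < fst f \<and> fst f < snd e \<and> snd e < snd f \<or>
    fst f < fst e \<and> fst e < snd f \<and> snd f < snd e"

text \<open>The ear cut off at the odd vertex \<open>q\<close> is the chord \<open>(q - 1, q + 1)\<close>; for the last vertex \<open>2 k - 1\<close>
  this wraps around and is written \<open>(0, 2 k - 2)\<close>.\<close>

definition ear :: "nat \<Rightarrow> nat \<Rightarrow> nat \<Rightarrow> bool" where
  "ear k a b \<longleftrightarrow> even a \<and> (b = a + 2 \<or> a = 0 \<and> b = 2 * k - 2)"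

text \<open>The subpolygon with vertices \<open>a..b\<close>, its sides included. The parameter
  \<open>k\<close> stays because the forbidden ears are those of the whole polygon.\<close>

definition chords :: "nat \<Rightarrow> nat \<Rightarrow> nat \<Rightarrow> (nat \<times> nat) set" where
  "chords k a b = {(x, y). a \<le> x \<and> x < y \<and> y \<le> b \<and> \<not> ear k x y}"

definition dissections :: "nat \<Rightarrow> nat \<Rightarrow> nat \<Rightarrow> (nat \<times> nat) set set" where
  "dissections k a b = maximal_independent (chords k a b) interleave"

lemma finite_chords: "finite (chords k a b)"
  by (rule finite_subset[of _ "{..b} \<times> {..b}"]) (auto simp: chords_def)

lemma finite_dissections: "finite (dissections k a b)"
  by (simp add: dissections_def finite_chords finite_maximal_independent)

lemma dissections_subset: "T \<in> dissections k a b \<Longrightarrow> T \<subseteq> chords k a b"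
  by (simp add: dissections_def maximal_independent_def)

lemma dissections_interleave:
  "T \<in> dissections k a b \<Longrightarrow> e \<in> T \<Longrightarrow> f \<in> T \<Longrightarrow> \<not> interleave e f"
  by (simp add: dissections_def maximal_independent_def)

lemma dissections_maximal:
  "T \<in> dissections k a b \<Longrightarrow> e \<in> chords k a b \<Longrightarrow> (\<And>f. f \<in> T \<Longrightarrow> \<not> interleave e f) \<Longrightarrow> e \<in> T"
  unfolding dissections_def maximal_independent_def by blast

lemma dissections_root:
  assumes "T \<in> dissections k a b" "a < b" "\<not> ear k a b"
  shows "(a, b) \<in> T"
  by (rule dissections_maximal[OF assms(1)])
    (use assms dissections_subset[OF assms(1)] in \<open>auto simp: chords_def interleave_def\<close>)

lemma dissections_edge:
  assumes "T \<in> dissections k a b" "a \<le> x" "Suc x \<le> b"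
  shows "(x, Suc x) \<in> T"
  by (rule dissections_maximal[OF assms(1)])
    (use assms in \<open>auto simp: chords_def interleave_def ear_def\<close>, presburger)

text \<open>Every root chord carries a triangle, although ears are missing from the universe. Let
  \<open>c\<close> be the last neighbour of \<open>a\<close> before \<open>b\<close>. Nothing in
  \<open>T\<close> crosses \<open>(c, b)\<close>, so it lies in \<open>T\<close> unless it is an
  ear; in that case \<open>(a, c + 1)\<close> would lie in \<open>T\<close>, against the choice of
  \<open>c\<close>.\<close>

lemma dissections_apex:
  assumes T: "T \<in> dissections k a b" and ab: "a + 2 \<le> b"
  obtains c where "a < c" "c < b" "(a, c) \<in> T" "(c, b) \<in> T"
proof -
  define C where "C = {c. c < b \<and> (a, c) \<in> T}"
  define c where "c = Max C"
  have sub: "a \<le> x \<and> x < y \<and> y \<le> b \<and> \<not> ear k x y" if "(x, y) \<in> T" for x y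
    using dissections_subset[OF T] that by (auto simp: chords_def)
  have fin: "finite C" unfolding C_def by simp
  have "Suc a \<in> C" using dissections_edge[OF T, of a] ab by (simp add: C_def)
  then have "c \<in> C" unfolding c_def using fin Max_in by blast
  then have c: "c < b" "(a, c) \<in> T" "a < c" using sub by (auto simp: C_def)
  have max: "y \<le> c" if "y < b" "(a, y) \<in> T" for y
    unfolding c_def by (rule Max_ge[OF fin]) (simp add: C_def that)
  have cross: "\<not> (a < x \<and> x < c \<and> c < y)" if "(x, y) \<in> T" for x y
    using dissections_interleave[OF T c(2) that] by (auto simp: interleave_def)
  have "(c, b) \<in> T"
  proof (cases "ear k c b")
    case False
    show ?thesis
    proof (rule dissections_maximal[OF T])
      show "(c, b) \<in> chords k a b" using c False by (simp add: chords_def)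
      fix f assume f: "f \<in> T"
      obtain x y where xy: "f = (x, y)" by (cases f)
      show "\<not> interleave (c, b) f"
        using f xy sub[of x y] max[of y] cross[of x y] by (auto simp: interleave_def)
    qed
  next
    case True
    then have b: "even c" "b = c + 2" using c by (auto simp: ear_def)
    \<comment> \<open>A chord of \<open>T\<close> crossing \<open>(a, c + 1)\<close> but not
      \<open>(a, c)\<close> starts at \<open>c\<close> and ends at \<open>b = c + 2\<close>, so it
      is the ear \<open>(c, b)\<close>.\<close>
    have "(a, Suc c) \<in> T"
    proof (rule dissections_maximal[OF T])
      show "(a, Suc c) \<in> chords k a b" using c b by (auto simp: chords_def ear_def) presburger
      fix f assume f: "f \<in> T"
      obtain x y where xy: "f = (x, y)" by (cases f)
      show "\<not> interleave (a, Suc c) f"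
        using f xy sub[of x y] cross[of x y] b True by (cases "x = c"; cases "y = b") (auto simp: interleave_def)
    qed
    with max[of "Suc c"] b show ?thesis by simp
  qed
  with c that show thesis by blast
qed

text \<open>Here \<open>x < c < y\<close>. The chord cuts \<open>(a, c)\<close> if
  \<open>a < x\<close> and \<open>(c, b)\<close> if \<open>y < b\<close>; only the root does
  neither.\<close>

lemma chords_straddling:
  assumes "(x, y) \<in> chords k a b" "a < c" "c < b" "(x, y) \<notin> chords k a c" "(x, y) \<notin> chords k c b"
    "(x, y) \<noteq> (a, b)"
  shows "interleave (x, y) (a, c) \<or> interleave (x, y) (c, b)"
  using assms by (auto simp: chords_def interleave_def)

lemma dissections_decompose:
  assumes T: "T \<in> dissections k a b" and c: "a < c" "c < b" "(a, c) \<in> T" "(c, b) \<in> T"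
    and root: "\<not> ear k a b"
  shows "T \<inter> chords k a c \<in> dissections k a c" "T \<inter> chords k c b \<in> dissections k c b"
    "T = insert (a, b) (T \<inter> chords k a c \<union> T \<inter> chords k c b)"
proof -
  have sub: "T \<subseteq> chords k a b" by (rule dissections_subset[OF T])
  show dec: "T = insert (a, b) (T \<inter> chords k a c \<union> T \<inter> chords k c b)"
  proof (intro equalityI subsetI)
    fix f assume f: "f \<in> T"
    obtain x y where xy: "f = (x, y)" by (cases f)
    have "\<not> interleave (x, y) (a, c)" "\<not> interleave (x, y) (c, b)"
      using dissections_interleave[OF T] f c xy by auto
    with chords_straddling[of x y k a b c] f sub c xy
    show "f \<in> insert (a, b) (T \<inter> chords k a c \<union> T \<inter> chords k c b)" by auto
  qed (use dissections_root[OF T _ root] c in auto)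
  show "T \<inter> chords k a c \<in> dissections k a c"
    unfolding dissections_def maximal_independent_def
  proof (intro CollectI conjI ballI)
    fix e assume e: "e \<in> chords k a c - T \<inter> chords k a c"
    then have "e \<in> chords k a b" "e \<notin> T" using c by (auto simp: chords_def)
    then obtain f where f: "f \<in> T" "interleave e f" using dissections_maximal[OF T] by blast
    \<comment> \<open>Neither the root nor a chord beyond \<open>c\<close> can cross a chord within
      \<open>a..c\<close>, so the witness \<open>f\<close> lies on the same side as
      \<open>e\<close>.\<close>
    have "f = (a, b) \<or> f \<in> chords k a c \<or> f \<in> chords k c b" using f dec by blast
    with f e c have "f \<in> chords k a c"
      by (auto simp: chords_def interleave_def)
    with f show "\<exists>f\<in>T \<inter> chords k a c. interleave e f" by blast
  qed (use dissections_interleave[OF T] in auto)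
  show "T \<inter> chords k c b \<in> dissections k c b"
    unfolding dissections_def maximal_independent_def
  proof (intro CollectI conjI ballI)
    fix e assume e: "e \<in> chords k c b - T \<inter> chords k c b"
    then have "e \<in> chords k a b" "e \<notin> T" using c by (auto simp: chords_def)
    then obtain f where f: "f \<in> T" "interleave e f" using dissections_maximal[OF T] by blast
    have "f = (a, b) \<or> f \<in> chords k a c \<or> f \<in> chords k c b" using f dec by blast
    with f e c have "f \<in> chords k c b"
      by (auto simp: chords_def interleave_def)
    with f show "\<exists>f\<in>T \<inter> chords k c b. interleave e f" by blast
  qed (use dissections_interleave[OF T] in auto)
qed

lemma dissections_compose:
  assumes T1: "T1 \<in> dissections k a c" and T2: "T2 \<in> dissections k c b"
    and c: "a < c" "c < b" "\<not> ear k a c" "\<not> ear k c b" and root: "\<not> ear k a b"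
  shows "insert (a, b) (T1 \<union> T2) \<in> dissections k a b" (is "?T \<in> _")
    "insert (a, b) (T1 \<union> T2) \<inter> chords k a c = T1"
    "insert (a, b) (T1 \<union> T2) \<inter> chords k c b = T2"
    "(a, c) \<in> insert (a, b) (T1 \<union> T2)" "(c, b) \<in> insert (a, b) (T1 \<union> T2)"
proof -
  have sub: "T1 \<subseteq> chords k a c" "T2 \<subseteq> chords k c b"
    using T1 T2 by (auto dest: dissections_subset)
  have r: "(a, c) \<in> T1" "(c, b) \<in> T2"
    using dissections_root[OF T1] dissections_root[OF T2] c by auto
  then show "(a, c) \<in> ?T" "(c, b) \<in> ?T" by auto
  show "?T \<inter> chords k a c = T1" "?T \<inter> chords k c b = T2"
    using sub c by (auto simp: chords_def)
  show "?T \<in> dissections k a b"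
    unfolding dissections_def maximal_independent_def
  proof (intro CollectI conjI ballI)
    show "?T \<subseteq> chords k a b" using sub c root by (auto simp: chords_def)
  next
    fix e f assume "e \<in> ?T" "f \<in> ?T"
    then consider "e \<in> T1 \<and> f \<in> T1" | "e \<in> T2 \<and> f \<in> T2" | "e = (a, b) \<or> f = (a, b)"
      | "e \<in> T1 \<and> f \<in> T2 \<or> e \<in> T2 \<and> f \<in> T1" by blast
    then show "\<not> interleave e f"
    proof cases
      case 3
      have "e \<in> chords k a b" "f \<in> chords k a b"
        using \<open>e \<in> ?T\<close> \<open>f \<in> ?T\<close> sub c root by (auto simp: chords_def)
      with 3 show ?thesis by (auto simp: chords_def interleave_def)
    next
      case 4
      then have "e \<in> chords k a c \<and> f \<in> chords k c b \<or> e \<in> chords k c b \<and> f \<in> chords k a c"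
        using sub by blast
      then show ?thesis by (auto simp: chords_def interleave_def)
    qed (use dissections_interleave[OF T1] dissections_interleave[OF T2] in auto)
  next
    fix e assume e: "e \<in> chords k a b - ?T"
    obtain x y where xy: "e = (x, y)" by (cases e)
    consider "e \<in> chords k a c" | "e \<in> chords k c b"
      | "interleave e (a, c) \<or> interleave e (c, b)"
      using chords_straddling[of x y k a b c] e c xy by auto
    then show "\<exists>f\<in>?T. interleave e f"
    proof cases
      case 1
      then show ?thesis using dissections_maximal[OF T1, of e] e by blast
    next
      case 2
      then show ?thesis using dissections_maximal[OF T2, of e] e by blast
    next
      case 3
      then show ?thesis using r by blast
    qed
  qed
qed

section \<open>The recurrence over the apex of the root triangle\<close>

definition dissection_count :: "nat \<Rightarrow> nat \<Rightarrow> nat \<Rightarrow> nat" where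
  "dissection_count k a b = (if ear k a b then 0 else card (dissections k a b))"

lemma dissection_count_edge: "dissection_count k a (Suc a) = 1"
proof -
  have ne: "\<not> ear k a (Suc a)" by (auto simp: ear_def) presburger
  then have "chords k a (Suc a) = {(a, Suc a)}" by (auto simp: chords_def le_Suc_eq)
  then have "dissections k a (Suc a) = {{(a, Suc a)}}"
    by (auto simp: dissections_def maximal_independent_def interleave_def)
  with ne show ?thesis by (simp add: dissection_count_def)
qed

text \<open>Each dissection has exactly one apex \<open>c\<close>, and its restrictions to the two
  sides of \<open>c\<close> are independent. The value 0 that \<open>dissection_count\<close>
  assigns to ears removes the apexes whose triangle would have an ear as a side.\<close>

lemma dissection_count_rec:
  assumes ab: "a + 2 \<le> b" and root: "\<not> ear k a b"
  shows "dissection_count k a b = (\<Sum>c\<in>{a<..<b}. dissection_count k a c * dissection_count k c b)"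
proof -
  define C where "C = {c \<in> {a<..<b}. \<not> ear k a c \<and> \<not> ear k c b}"
  define D where "D c = {T \<in> dissections k a b. (a, c) \<in> T \<and> (c, b) \<in> T}" for c
  have un: "dissections k a b = (\<Union>c\<in>C. D c)"
  proof (intro equalityI subsetI)
    fix T assume T: "T \<in> dissections k a b"
    obtain c where c: "a < c" "c < b" "(a, c) \<in> T" "(c, b) \<in> T"
      using dissections_apex[OF T ab] .
    with dissections_subset[OF T] have "c \<in> C" by (auto simp: C_def chords_def)
    with c T show "T \<in> (\<Union>c\<in>C. D c)" by (auto simp: D_def)
  qed (auto simp: D_def)
  have card_D: "card (D c) = card (dissections k a c) * card (dissections k c b)" if "c \<in> C" for c
  proof -
    have c: "a < c" "c < b" "\<not> ear k a c" "\<not> ear k c b" using that by (auto simp: C_def)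
    have "bij_betw (\<lambda>(T1, T2). insert (a, b) (T1 \<union> T2)) (dissections k a c \<times> dissections k c b) (D c)"
    proof (rule bij_betwI[where g = "\<lambda>T. (T \<inter> chords k a c, T \<inter> chords k c b)"])
      show "(\<lambda>(T1, T2). insert (a, b) (T1 \<union> T2)) \<in> dissections k a c \<times> dissections k c b \<rightarrow> D c"
      proof (rule funcsetI, unfold mem_Times_iff, elim conjE)
        fix P assume "fst P \<in> dissections k a c" "snd P \<in> dissections k c b"
        then show "(case P of (T1, T2) \<Rightarrow> insert (a, b) (T1 \<union> T2)) \<in> D c"
          unfolding D_def case_prod_beta using dissections_compose(1,4,5)[OF _ _ c root] by blast
      qed
      show "(\<lambda>T. (T \<inter> chords k a c, T \<inter> chords k c b)) \<in> D c \<rightarrow> dissections k a c \<times> dissections k c b"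
        using dissections_decompose(1,2)[OF _ c(1,2) _ _ root] unfolding D_def by blast
    next
      fix P assume P: "P \<in> dissections k a c \<times> dissections k c b"
      obtain T1 T2 where T: "P = (T1, T2)" by (cases P)
      show "((case P of (T1, T2) \<Rightarrow> insert (a, b) (T1 \<union> T2)) \<inter> chords k a c,
          (case P of (T1, T2) \<Rightarrow> insert (a, b) (T1 \<union> T2)) \<inter> chords k c b) = P"
        using dissections_compose(2,3)[OF _ _ c root, of T1 T2] P by (simp add: T)
    next
      fix T assume "T \<in> D c"
      then show "(case (T \<inter> chords k a c, T \<inter> chords k c b) of (T1, T2) \<Rightarrow> insert (a, b) (T1 \<union> T2)) = T"
        using dissections_decompose(3)[OF _ c(1,2) _ _ root, of T, symmetric] by (simp add: D_def)
    qed
    then show ?thesis by (simp add: bij_betw_same_card[symmetric] card_cartesian_product)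
  qed
  have disj: "D c \<inter> D c' = {}" if "c \<in> C" "c' \<in> C" "c \<noteq> c'" for c c'
  proof -
    \<comment> \<open>Two apexes \<open>y < x\<close> would put the crossing chords
      \<open>(a, x)\<close> and \<open>(y, b)\<close> into \<open>T\<close>.\<close>
    have False if T: "T \<in> dissections k a b" and "(a, x) \<in> T" "(y, b) \<in> T" "a < y" "y < x" "x < b"
      for T x y
      using dissections_interleave[OF T that(2,3)] that by (auto simp: interleave_def)
    with that show ?thesis by (auto simp: D_def C_def) (metis linorder_neqE_nat)
  qed
  have "card (dissections k a b) = (\<Sum>c\<in>C. card (D c))"
    unfolding un by (rule card_UN_disjoint)
      (use disj in \<open>auto simp: C_def D_def intro: finite_subset[OF _ finite_dissections[of k a b]]\<close>)
  also have "\<dots> = (\<Sum>c\<in>C. dissection_count k a c * dissection_count k c b)"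
    by (rule sum.cong) (auto simp: card_D dissection_count_def, auto simp: C_def)
  also have "\<dots> = (\<Sum>c\<in>{a<..<b}. dissection_count k a c * dissection_count k c b)"
    by (rule sum.mono_neutral_left) (auto simp: C_def dissection_count_def)
  finally show ?thesis using root by (simp add: dissection_count_def)
qed

subsection \<open>Counting by Catalan moments\<close>

text \<open>Only meaningful for \<open>e \<le> m\<close>, because of the truncated \<open>m - e\<close>.\<close>

definition cat_moment :: "nat \<Rightarrow> nat \<Rightarrow> real" where
  "cat_moment m e = 4 / pi *
    integral {0..pi/2} (\<lambda>t. (4 * (cos t)\<^sup>2) ^ (m - e) * (4 * (cos t)\<^sup>2 - 1) ^ e * (sin t)\<^sup>2)"

text \<open>Under the integral this is \<open>x^i (x - 1) = x^(i+1) - x^i\<close> with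
  \<open>x = 4 cos^2 t\<close>. It is the counting step for one more mark: unmarked vertex minus
  deleted vertex.\<close>

lemma cat_moment_Suc_Suc:
  assumes "e \<le> m"
  shows "cat_moment (Suc m) (Suc e) = cat_moment (Suc m) e - cat_moment m e"
proof -
  let ?f = "\<lambda>i t. (4 * (cos t)\<^sup>2) ^ i * (4 * (cos t)\<^sup>2 - 1) ^ e * (sin t)\<^sup>2 :: real"
  have int: "?f i integrable_on {0..pi/2}" for i
    by (intro integrable_continuous_real continuous_intros)
  have "(4 * (cos t)\<^sup>2) ^ (Suc m - Suc e) * (4 * (cos t)\<^sup>2 - 1) ^ Suc e * (sin t)\<^sup>2
      = ?f (Suc m - e) t - ?f (m - e) t" for t :: real
    using assms by (simp add: Suc_diff_le algebra_simps)
  then have "cat_moment (Suc m) (Suc e) =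
      4 / pi * integral {0..pi/2} (\<lambda>t. ?f (Suc m - e) t - ?f (m - e) t)"
    unfolding cat_moment_def by presburger
  also have "\<dots> = cat_moment (Suc m) e - cat_moment m e"
    unfolding cat_moment_def using integral_diff[OF int int]
    by (simp add: right_diff_distrib)
  finally show ?thesis .
qed

lemma cat_moment_0_0: "cat_moment 0 0 = 1"
proof -
  have "((\<lambda>t. (sin t)\<^sup>2) has_integral
      ((pi/2 - sin (pi/2) * cos (pi/2)) / 2 - (0 - sin 0 * cos 0) / 2)) {0..pi/2}"
  proof (rule fundamental_theorem_of_calculus)
    fix t :: real
    have "((\<lambda>t. (t - sin t * cos t) / 2) has_real_derivative (1 - ((cos t)\<^sup>2 - (sin t)\<^sup>2)) / 2)
        (at t within {0..pi/2})"
      by (auto intro!: derivative_eq_intros simp: power2_eq_square)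
    also have "(1 - ((cos t)\<^sup>2 - (sin t)\<^sup>2)) / 2 = (sin t)\<^sup>2" by (simp add: cos_squared_eq)
    finally show "((\<lambda>t. (t - sin t * cos t) / 2) has_vector_derivative (sin t)\<^sup>2) (at t within {0..pi/2})"
      by (simp add: has_real_derivative_iff_has_vector_derivative)
  qed simp
  then show ?thesis by (simp add: cat_moment_def integral_unique)
qed

text \<open>Integration by parts gives the first-order recurrence of the Catalan numbers:
  \<open>F\<close> vanishes at 0 and at \<open>pi/2\<close>, and its derivative is the difference of
  the two integrands.\<close>

lemma cat_moment_Suc_0:
  "real (m + 2) * cat_moment (Suc m) 0 = real (4 * m + 2) * cat_moment m 0"
proof -
  let ?f = "\<lambda>i t. (4 * (cos t)\<^sup>2) ^ i * (sin t)\<^sup>2 :: real"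
  define F where "F t = 2 * 4 ^ m * (sin t) ^ 3 * (cos t) ^ (2 * m + 1)" for t :: real
  have int: "?f i integrable_on {0..pi/2}" for i
    by (intro integrable_continuous_real continuous_intros)
  have "(F has_real_derivative (real (m + 2) * ?f (Suc m) t - real (4 * m + 2) * ?f m t))
      (at t within {0..pi/2})" for t
  proof -
    have "(F has_real_derivative
        2 * 4 ^ m * (3 * (sin t)\<^sup>2 * cos t * (cos t) ^ (2 * m + 1)
          - (sin t) ^ 3 * (real (2 * m + 1) * (cos t) ^ (2 * m) * sin t))) (at t within {0..pi/2})"
      unfolding F_def
      by (rule derivative_eq_intros refl)+ (simp add: algebra_simps eval_nat_numeral)
    also have "(sin t) ^ 3 * (real (2 * m + 1) * (cos t) ^ (2 * m) * sin t)
        = (sin t)\<^sup>2 * (1 - (cos t)\<^sup>2) * (real (2 * m + 1) * (cos t) ^ (2 * m))"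
      unfolding sin_squared_eq[of t, symmetric] by (simp add: eval_nat_numeral algebra_simps)
    also have "2 * 4 ^ m * (3 * (sin t)\<^sup>2 * cos t * (cos t) ^ (2 * m + 1) -
        (sin t)\<^sup>2 * (1 - (cos t)\<^sup>2) * (real (2 * m + 1) * (cos t) ^ (2 * m)))
      = real (m + 2) * ?f (Suc m) t - real (4 * m + 2) * ?f m t"
    proof -
      have "(cos t) ^ (2 * m) = (cos t) ^ m * (cos t) ^ m" by (simp add: mult_2 power_add)
      then show ?thesis by (simp add: power_mult_distrib algebra_simps power2_eq_square)
    qed
    finally show ?thesis .
  qed
  then have "((\<lambda>t. real (m + 2) * ?f (Suc m) t - real (4 * m + 2) * ?f m t) has_integral
      (F (pi/2) - F 0)) {0..pi/2}"
    by (intro fundamental_theorem_of_calculus)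
      (auto simp: has_real_derivative_iff_has_vector_derivative[symmetric])
  then have "integral {0..pi/2} (\<lambda>t. real (m + 2) * ?f (Suc m) t - real (4 * m + 2) * ?f m t) = 0"
    by (simp add: integral_unique F_def)
  moreover have "integral {0..pi/2} (\<lambda>t. real (m + 2) * ?f (Suc m) t - real (4 * m + 2) * ?f m t)
      = real (m + 2) * integral {0..pi/2} (?f (Suc m)) - real (4 * m + 2) * integral {0..pi/2} (?f m)"
    using integral_diff[OF integrable_on_mult_right[OF int] integrable_on_mult_right[OF int],
        of "real (m + 2)" "Suc m" "real (4 * m + 2)" m] by simp
  ultimately show ?thesis by (simp add: cat_moment_def)
qed

text \<open>These are the coefficients of \<open>sqrt (1 - 4 z) = 1 - 2 z C(z)\<close>, with
  \<open>C\<close> the Catalan generating function. Both sides obey the same first-order recurrence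
  in \<open>n\<close>.\<close>

lemma cat_moment_eq_gbinomial:
  "(1/2 gchoose Suc n) * (-4) ^ Suc n = - 2 * cat_moment n 0"
proof (induction n)
  case 0
  show ?case by (simp add: cat_moment_0_0)
next
  case (Suc n)
  have "real (n + 2) * ((1/2 gchoose Suc (Suc n)) * (-4) ^ Suc (Suc n))
      = (real (Suc (Suc n)) * (1/2 gchoose Suc (Suc n))) * (-4) ^ Suc (Suc n)" by simp
  also have "real (Suc (Suc n)) * (1/2 gchoose Suc (Suc n)) = (1/2 - real (Suc n)) * (1/2 gchoose Suc n :: real)"
    using gbinomial_absorb_comp[of "1/2::real" "Suc n"] gbinomial_absorption[of "Suc n" "1/2::real"]
    by simp
  also have "(1/2 - real (Suc n)) * (1/2 gchoose Suc n :: real) * (-4) ^ Suc (Suc n)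
      = real (4 * n + 2) * ((1/2 gchoose Suc n) * (-4) ^ Suc n)" by (simp add: algebra_simps)
  also have "\<dots> = - 2 * (real (4 * n + 2) * cat_moment n 0)" by (simp only: Suc.IH)
  also have "\<dots> = real (n + 2) * (- 2 * cat_moment (Suc n) 0)"
    by (simp only: cat_moment_Suc_0[symmetric])
  finally have eq: "real (n + 2) * ((1/2 gchoose Suc (Suc n)) * (-4) ^ Suc (Suc n))
      = real (n + 2) * (- 2 * cat_moment (Suc n) 0)" .
  have "real (n + 2) \<noteq> 0" by simp
  from mult_left_cancel[OF this, THEN iffD1, OF eq] show ?case .
qed

text \<open>The square of \<open>sqrt (1 - 4 z)\<close> is \<open>1 - 4 z\<close>, which has no term
  of degree \<open>n + 2\<close>; Vandermonde with \<open>1/2 + 1/2 = 1\<close> expresses this for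
  the coefficients.\<close>

lemma cat_moment_convolution:
  "(\<Sum>i\<le>n. cat_moment i 0 * cat_moment (n - i) 0) = cat_moment (Suc n) 0"
proof -
  define c :: "nat \<Rightarrow> real" where "c i = (1/2 gchoose i) * (-4) ^ i" for i
  have c: "c 0 = 1" "c (Suc i) = - 2 * cat_moment i 0" for i
    unfolding c_def by (simp_all only: cat_moment_eq_gbinomial) simp
  have "(\<Sum>i\<le>n+2. c i * c (n + 2 - i))
      = (\<Sum>i\<le>n+2. (1/2 gchoose i) * (1/2 gchoose (n + 2 - i))) * (-4) ^ (n + 2)"
    unfolding sum_distrib_right c_def
  proof (rule sum.cong)
    fix i assume "i \<in> {..n + 2}"
    then have "(-4 :: real) ^ (n + 2) = (-4) ^ i * (-4) ^ (n + 2 - i)"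
      by (simp add: power_add[symmetric])
    then show "(1/2 gchoose i) * (-4) ^ i * ((1/2 gchoose (n + 2 - i)) * (-4) ^ (n + 2 - i))
        = (1/2 gchoose i) * (1/2 gchoose (n + 2 - i)) * (-4 :: real) ^ (n + 2)" by simp
  qed simp
  also have "(\<Sum>i\<le>n+2. (1/2 gchoose i) * (1/2 gchoose (n + 2 - i)) :: real) = (1 gchoose (n + 2))"
    using gbinomial_Vandermonde[of "1/2::real" "1/2" "n+2"] by (simp add: atMost_atLeast0)
  also have "(1 gchoose (n + 2) :: real) = 0"
    using binomial_gbinomial[of 1 "n + 2", where 'a = real] by simp
  finally have "(\<Sum>i\<le>Suc (Suc n). c i * c (Suc (Suc n) - i)) = 0" by simp
  \<comment> \<open>The two extreme summands both equal \<open>c (n + 2)\<close>, because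
    \<open>c 0 = 1\<close>.\<close>
  also have "(\<Sum>i\<le>Suc (Suc n). c i * c (Suc (Suc n) - i))
      = 2 * c (Suc (Suc n)) + (\<Sum>i\<le>n. c (Suc i) * c (Suc n - i))"
    by (subst sum.atMost_Suc_shift) (simp add: c(1))
  also have "(\<Sum>i\<le>n. c (Suc i) * c (Suc n - i)) = 4 * (\<Sum>i\<le>n. cat_moment i 0 * cat_moment (n - i) 0)"
    unfolding sum_distrib_left by (rule sum.cong) (auto simp: c Suc_diff_le)
  finally show ?thesis by (simp add: c)
qed

text \<open>The Catalan convolution, reindexed by the rank \<open>r c\<close> of the apex. Arbitrary
  finite sets appear in place of intervals because marked vertices will be deleted from the
  middle.\<close>

lemma sum_cat_moment_unmarked:
  fixes I :: "nat set"
  assumes fin: "finite I" and ne: "I \<noteq> {}"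
  shows "(\<Sum>c\<in>I. cat_moment (card {x \<in> I. x < c}) 0 * cat_moment (card {x \<in> I. c < x}) 0)
    = cat_moment (card I) 0"
proof -
  define r where "r c = card {x \<in> I. x < c}" for c
  obtain n where n: "card I = Suc n" using fin ne by (cases "card I") auto
  have less: "r c < r d" if "c \<in> I" "c < d" for c d
    unfolding r_def by (rule psubset_card_mono) (use fin that in auto)
  have inj: "inj_on r I" by (rule inj_onI) (metis less less_irrefl linorder_neqE_nat)
  have tot: "r c + card {x \<in> I. c < x} = n" if "c \<in> I" for c
  proof -
    have "I = insert c ({x \<in> I. x < c} \<union> {x \<in> I. c < x})" using that by auto
    then have "card I = card (insert c ({x \<in> I. x < c} \<union> {x \<in> I. c < x}))" by simp
    also have "\<dots> = Suc (r c + card {x \<in> I. c < x})"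
      unfolding r_def using fin by (subst card_insert_disjoint) (auto intro!: card_Un_disjoint)
    finally show ?thesis using n by simp
  qed
  have "r ` I = {..n}"
    by (rule card_subset_eq) (use tot n card_image[OF inj] in \<open>auto, force\<close>)
  then have "(\<Sum>c\<in>I. cat_moment (r c) 0 * cat_moment (n - r c) 0)
      = (\<Sum>i\<le>n. cat_moment i 0 * cat_moment (n - i) 0)"
    using sum.reindex[OF inj, of "\<lambda>i. cat_moment i 0 * cat_moment (n - i) 0"] by simp
  moreover have "card {x \<in> I. c < x} = n - r c" if "c \<in> I" for c using tot[OF that] by simp
  ultimately show ?thesis by (simp add: n cat_moment_convolution r_def)
qed

text \<open>Inclusion--exclusion, one marked vertex at a time: a polygon with a forbidden ear at \<open>q\<close> counts
  all triangulations minus those that have the ear, i.e. minus those of the polygon without \<open>q\<close>.\<close>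

lemma sum_cat_moment_marked:
  fixes I B :: "nat set"
  assumes "finite I" "B \<subset> I"
  shows "(\<Sum>c\<in>I. cat_moment (card {x \<in> I. x < c}) (card {x \<in> B. x < c}) *
      cat_moment (card {x \<in> I. c < x}) (card {x \<in> B. c < x})) = cat_moment (card I) (card B)"
proof -
  define L where "L I B c = cat_moment (card {x \<in> I. x < c}) (card {x \<in> B. x < c})" for I B and c :: nat
  define R where "R I B c = cat_moment (card {x \<in> I. c < x}) (card {x \<in> B. c < x})" for I B and c :: nat
  \<comment> \<open>\<open>cat_moment_Suc_Suc\<close> for sets: \<open>q\<close> marked equals
    \<open>q\<close> unmarked minus \<open>q\<close> deleted.\<close>
  have pascal: "cat_moment (card I) (card B)
      = cat_moment (card I) (card (B - {q})) - cat_moment (card (I - {q})) (card (B - {q}))"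
    if "finite I" "B \<subseteq> I" "q \<in> B" for I B and q :: nat
  proof -
    have fB: "finite B" "q \<in> I" using that finite_subset by auto
    have "card I = Suc (card (I - {q}))" "card B = Suc (card (B - {q}))"
      using card.remove[of I q] card.remove[of B q] that fB by auto
    moreover have "card (B - {q}) \<le> card (I - {q})" using that by (intro card_mono) auto
    ultimately show ?thesis using cat_moment_Suc_Suc by presburger
  qed
  have "finite B" using assms finite_subset by auto
  then have "B \<subset> I \<Longrightarrow> finite I \<Longrightarrow> (\<Sum>c\<in>I. L I B c * R I B c) = cat_moment (card I) (card B)" for I
  proof (induction B arbitrary: I)
    case empty
    then show ?case using sum_cat_moment_unmarked[of I] by (simp add: L_def R_def psubset_eq)
  next
    case (insert q B)
    let ?J = "I - {q}"
    have q: "q \<in> I" "B \<subset> I" "B \<subset> ?J" "finite ?J" using insert by auto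
    \<comment> \<open>As \<open>q\<close> lies on one side of \<open>c\<close>, only one factor sees
      the mark and splits by \<open>pascal\<close>; the other factor is common to both
      products.\<close>
    have split: "L I (insert q B) c * R I (insert q B) c = L I B c * R I B c - L ?J B c * R ?J B c"
      if "c \<in> ?J" for c
    proof (cases "q < c")
      case True
      have "L I (insert q B) c = L I B c - L ?J B c"
      proof -
        have "{x \<in> insert q B. x < c} - {q} = {x \<in> B. x < c}" "{x \<in> I. x < c} - {q} = {x \<in> ?J. x < c}"
          using insert.hyps by auto
        moreover have "finite {x \<in> I. x < c}" "{x \<in> insert q B. x < c} \<subseteq> {x \<in> I. x < c}"
            "q \<in> {x \<in> insert q B. x < c}"
          using insert.prems True by auto
        ultimately show ?thesis
          using pascal[of "{x \<in> I. x < c}" "{x \<in> insert q B. x < c}" q] by (simp only: L_def)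
      qed
      moreover have "{x \<in> insert q B. c < x} = {x \<in> B. c < x}" "{x \<in> ?J. c < x} = {x \<in> I. c < x}"
        using True by auto
      then have "R I (insert q B) c = R I B c" "R ?J B c = R I B c" by (simp_all only: R_def)
      ultimately show ?thesis by (simp add: left_diff_distrib)
    next
      case False
      then have cq: "c < q" using that by auto
      have "R I (insert q B) c = R I B c - R ?J B c"
      proof -
        have "{x \<in> insert q B. c < x} - {q} = {x \<in> B. c < x}" "{x \<in> I. c < x} - {q} = {x \<in> ?J. c < x}"
          using insert.hyps by auto
        moreover have "finite {x \<in> I. c < x}" "{x \<in> insert q B. c < x} \<subseteq> {x \<in> I. c < x}"
            "q \<in> {x \<in> insert q B. c < x}"
          using insert.prems cq by auto
        ultimately show ?thesis
          using pascal[of "{x \<in> I. c < x}" "{x \<in> insert q B. c < x}" q] by (simp only: R_def)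
      qed
      moreover have "{x \<in> insert q B. x < c} = {x \<in> B. x < c}" "{x \<in> ?J. x < c} = {x \<in> I. x < c}"
        using cq by auto
      then have "L I (insert q B) c = L I B c" "L ?J B c = L I B c" by (simp_all only: L_def)
      ultimately show ?thesis by (simp add: right_diff_distrib)
    qed
    \<comment> \<open>At the apex \<open>q\<close> the mark is invisible, since both factors count
      strictly to one side. Hence the subtracted sum runs over \<open>?J\<close> alone, as the
      induction hypothesis for \<open>?J\<close> requires.\<close>
    have at_q: "L I (insert q B) q * R I (insert q B) q = L I B q * R I B q"
    proof -
      have "{x \<in> insert q B. x < q} = {x \<in> B. x < q}" "{x \<in> insert q B. q < x} = {x \<in> B. q < x}" by auto
      then show ?thesis by (simp only: L_def R_def)
    qed
    have "(\<Sum>c\<in>I. L I (insert q B) c * R I (insert q B) c)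
        = L I B q * R I B q + (\<Sum>c\<in>?J. L I B c * R I B c - L ?J B c * R ?J B c)"
      using q insert.prems by (simp add: sum.remove[of I q] at_q split)
    also have "\<dots> = (\<Sum>c\<in>I. L I B c * R I B c) - (\<Sum>c\<in>?J. L ?J B c * R ?J B c)"
      using q insert.prems by (simp add: sum.remove[of I q] sum_subtractf)
    also have "\<dots> = cat_moment (card I) (card B) - cat_moment (card ?J) (card B)"
      using insert.IH[of I] insert.IH[of ?J] q insert.prems by simp
    also have "\<dots> = cat_moment (card I) (card (insert q B))"
      using pascal[of I "insert q B" q] insert by auto
    finally show ?case .
  qed
  with assms show ?thesis by (simp add: L_def R_def)
qed

text \<open>Ends carry no mark: the ear of the subpolygon at one end has the other end as an
  endpoint, so it is not the ear of the whole polygon there. The exception is the vertex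
  \<open>2 k - 1\<close> of the full interval.\<close>

definition interval_weight :: "nat \<Rightarrow> nat \<Rightarrow> real" where
  "interval_weight a b = cat_moment (card {a<..<b}) (card {x \<in> {a<..<b}. odd x})"

lemma interval_weight_edge: "interval_weight a (Suc a) = 1"
proof -
  have "{a<..<Suc a} = {}" by auto
  then show ?thesis by (simp add: interval_weight_def cat_moment_0_0)
qed

text \<open>The single inner vertex is marked, which gives \<open>C_1 - C_0 = 0\<close>. The apex
  sum would be 1, so the recurrence has to leave out this case.\<close>

lemma interval_weight_ear:
  assumes "even a" shows "interval_weight a (a + 2) = 0"
proof -
  have "{a<..<a+2} = {Suc a}" by auto
  moreover have "{x. x = Suc a \<and> odd x} = {Suc a}" using assms by auto
  ultimately show ?thesis
    using cat_moment_Suc_Suc[of 0 0] cat_moment_Suc_0[of 0] by (simp add: interval_weight_def cat_moment_0_0)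
qed

lemma interval_weight_rec:
  assumes "a + 2 \<le> b" "\<not> (even a \<and> b = a + 2)"
  shows "(\<Sum>c\<in>{a<..<b}. interval_weight a c * interval_weight c b) = interval_weight a b"
proof -
  let ?I = "{a<..<b}" and ?B = "{x \<in> {a<..<b}. odd x}"
  \<comment> \<open>Strict inclusion of the marked vertices needs an even inner vertex; one of the
    first two inner vertices is even, and it is absent only for the ear.\<close>
  obtain x where x: "x \<in> ?I" "even x"
  proof (cases "even a")
    case True
    with assms that[of "a + 2"] show ?thesis by auto
  next
    case False
    with assms that[of "a + 1"] show ?thesis by auto
  qed
  from x have "x \<notin> ?B" by simp
  with x(1) have psub: "?B \<subset> ?I" by blast
  have "{x \<in> ?I. x < c} = {a<..<c}" "{x \<in> ?I. c < x} = {c<..<b}"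
    "{x \<in> ?B. x < c} = {x \<in> {a<..<c}. odd x}" "{x \<in> ?B. c < x} = {x \<in> {c<..<b}. odd x}"
    if "c \<in> ?I" for c
    using that by auto
  then have "(\<Sum>c\<in>?I. cat_moment (card {x \<in> ?I. x < c}) (card {x \<in> ?B. x < c}) *
      cat_moment (card {x \<in> ?I. c < x}) (card {x \<in> ?B. c < x}))
      = (\<Sum>c\<in>?I. interval_weight a c * interval_weight c b)"
    unfolding interval_weight_def by (intro sum.cong refl) presburger
  with sum_cat_moment_marked[OF _ psub] show ?thesis by (simp add: interval_weight_def)
qed

text \<open>The third hypothesis keeps out the chord \<open>(0, 2 k - 2)\<close>, the ear that the
  parity of inner vertices does not detect. Within such intervals both sides have the same
  recurrence and initial values.\<close>

lemma dissection_count_eq_weight: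
  assumes "a < b" "b < 2 * k" "0 < a \<or> b < 2 * k - 2"
  shows "real (dissection_count k a b) = interval_weight a b"
  using assms
proof (induction "b - a" arbitrary: a b rule: less_induct)
  case less
  consider "b = Suc a" | "ear k a b" | "a + 2 \<le> b" "\<not> ear k a b" using less.prems by linarith
  then show ?case
  proof cases
    case 1
    then show ?thesis using dissection_count_edge by (simp add: interval_weight_edge)
  next
    case 2
    then show ?thesis using less.prems interval_weight_ear[of a]
      by (auto simp: dissection_count_def ear_def)
  next
    case 3
    have "real (dissection_count k a b)
        = (\<Sum>c\<in>{a<..<b}. real (dissection_count k a c) * real (dissection_count k c b))"
      using dissection_count_rec[OF 3] by simp
    also have "\<dots> = (\<Sum>c\<in>{a<..<b}. interval_weight a c * interval_weight c b)"
      using less by (intro sum.cong) auto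
    also have "\<dots> = interval_weight a b" using 3 by (intro interval_weight_rec) (auto simp: ear_def)
    finally show ?thesis .
  qed
qed

lemma card_odd_less_double: "card {x \<in> {0<..<2 * n}. odd x} = n"
proof -
  have "{x \<in> {0<..<2 * n}. odd x} = (\<lambda>i. 2 * i + 1) ` {..<n}"
  proof (intro equalityI subsetI)
    fix x assume "x \<in> {x \<in> {0<..<2 * n}. odd x}"
    then have "x = 2 * (x div 2) + 1" "x div 2 \<in> {..<n}" by auto
    then show "x \<in> (\<lambda>i. 2 * i + 1) ` {..<n}" by (rule image_eqI)
  qed auto
  then show ?thesis by (simp add: card_image inj_on_def)
qed

text \<open>The triangle with apex \<open>2 k - 2\<close> on the root \<open>(0, 2 k - 1)\<close>
  has the wrapped ear as a side and contributes 0, while the weights credit it with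
  \<open>interval_weight 0 (2 k - 2)\<close>. Subtracting this credit is one more use of
  \<open>cat_moment_Suc_Suc\<close>: it marks the last vertex and raises \<open>k - 1\<close> marks
  to \<open>k\<close>.\<close>

lemma dissection_count_double_circle:
  assumes k: "k \<ge> 3"
  shows "real (dissection_count k 0 (2 * k - 1)) = cat_moment (2 * k - 2) k"
proof -
  let ?n = "2 * k - 1"
  have I: "{0<..<?n} = insert (2 * k - 2) {0<..<2 * k - 2}" using k by auto
  have ear: "ear k 0 (2 * k - 2)" "\<not> ear k 0 ?n" using k by (auto simp: ear_def)
  have "real (dissection_count k 0 ?n)
      = (\<Sum>c\<in>{0<..<?n}. real (dissection_count k 0 c) * real (dissection_count k c ?n))"
    using dissection_count_rec[of 0 ?n k] ear k by simp
  also have "\<dots> = (\<Sum>c\<in>{0<..<2 * k - 2}. real (dissection_count k 0 c) * real (dissection_count k c ?n))"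
    unfolding I using ear by (simp add: dissection_count_def)
  also have "\<dots> = (\<Sum>c\<in>{0<..<2 * k - 2}. interval_weight 0 c * interval_weight c ?n)"
    using k by (intro sum.cong refl) (auto simp: dissection_count_eq_weight)
  also have "\<dots> = (\<Sum>c\<in>{0<..<?n}. interval_weight 0 c * interval_weight c ?n)
      - interval_weight 0 (2 * k - 2) * interval_weight (2 * k - 2) ?n"
    unfolding I by simp
  also have "(\<Sum>c\<in>{0<..<?n}. interval_weight 0 c * interval_weight c ?n) = interval_weight 0 ?n"
    using k by (intro interval_weight_rec) auto
  also have "interval_weight (2 * k - 2) ?n = 1"
    using interval_weight_edge[of "2 * k - 2"] k by (simp add: numeral_2_eq_2 Suc_diff_Suc)
  finally have "real (dissection_count k 0 ?n) = interval_weight 0 ?n - interval_weight 0 (2 * (k - 1))"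
    by (simp add: diff_mult_distrib2)
  moreover have "{x \<in> {0<..<?n}. odd x} = {x \<in> {0<..<2 * (k - 1)}. odd x}"
    using k by (auto simp: diff_mult_distrib2) presburger
  then have "interval_weight 0 ?n = cat_moment (2 * k - 2) (k - 1)"
    by (simp only: interval_weight_def card_odd_less_double card_greaterThanLessThan) (simp add: numeral_2_eq_2)
  moreover have "card {0<..<2 * (k - 1)} = 2 * k - 3" by simp
  then have "interval_weight 0 (2 * (k - 1)) = cat_moment (2 * k - 3) (k - 1)"
    by (simp only: interval_weight_def card_odd_less_double)
  moreover have s: "2 * k - 2 = Suc (2 * k - 3)" using k by simp
  ultimately have "real (dissection_count k 0 ?n)
      = cat_moment (Suc (2 * k - 3)) (k - 1) - cat_moment (2 * k - 3) (k - 1)"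
    by (simp only:)
  also have "\<dots> = cat_moment (Suc (2 * k - 3)) (Suc (k - 1))"
    using k by (intro cat_moment_Suc_Suc[symmetric]) auto
  also have "Suc (k - 1) = k" using k by simp
  finally show ?thesis by (simp only: s)
qed

subsection \<open>Geometry of the double circle\<close>

definition orient :: "point \<Rightarrow> point \<Rightarrow> point \<Rightarrow> real" where
  "orient p q r = (fst q - fst p) * (snd r - snd p) - (snd q - snd p) * (fst r - fst p)"

lemma orient_cycle: "orient p q r = orient q r p"
  by (simp add: orient_def algebra_simps)

lemma orient_swap: "orient p q r = - orient q p r"
  by (simp add: orient_def algebra_simps)

lemma orient_degenerate: "orient p p r = 0" "orient p q p = 0" "orient p q q = 0"
  by (simp_all add: orient_def algebra_simps)

lemma orient_affine:
  "orient p q ((1 - u) *\<^sub>R r + u *\<^sub>R s) = (1 - u) * orient p q r + u * orient p q s"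
  by (simp add: orient_def algebra_simps)

lemma orient_midpoint:
  "orient (midpoint p p') q r = (orient p q r + orient p' q r) / 2"
  "orient p (midpoint q q') r = (orient p q r + orient p q' r) / 2"
  "orient p q (midpoint r r') = (orient p q r + orient p q r') / 2"
  by (simp_all add: orient_def midpoint_def field_simps)

text \<open>Both \<open>C\<close> and \<open>D\<close> lie strictly on one side of the line
  \<open>A B\<close>, and orientation is affine along \<open>C D\<close>, so it cannot vanish
  there.\<close>

lemma segments_disjoint_if_orient:
  assumes "orient A B C * orient A B D > 0"
  shows "closed_segment A B \<inter> closed_segment C D = {}"
proof (rule ccontr)
  assume "\<not> ?thesis"
  then obtain u v where u: "0 \<le> u" "u \<le> 1" and
      eq: "(1 - v) *\<^sub>R A + v *\<^sub>R B = (1 - u) *\<^sub>R C + u *\<^sub>R D"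
    unfolding closed_segment_def by blast
  have "(1 - u) * orient A B C + u * orient A B D = orient A B ((1 - v) *\<^sub>R A + v *\<^sub>R B)"
    unfolding eq by (simp only: orient_affine)
  also have "\<dots> = 0" by (simp add: orient_affine orient_degenerate)
  finally have 0: "(1 - u) * orient A B C + u * orient A B D = 0" .
  consider "orient A B C > 0" "orient A B D > 0" | "orient A B C < 0" "orient A B D < 0"
    using assms by (auto simp: zero_less_mult_iff)
  then show False
  proof cases
    case 1
    then have "(1 - u) * orient A B C + u * orient A B D > 0"
      using u by (cases "u = 0") (auto intro!: add_nonneg_pos)
    with 0 show False by simp
  next
    case 2
    then have "(1 - u) * orient A B C + u * orient A B D < 0"
      using u by (cases "u = 0") (auto intro!: add_nonpos_neg mult_nonneg_nonpos mult_pos_neg)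
    with 0 show False by simp
  qed
qed

lemma segments_meet_if_orient:
  assumes "orient A B C * orient A B D < 0" "orient C D A * orient C D B < 0"
  shows "closed_segment A B \<inter> closed_segment C D \<noteq> {}"
proof -
  define a b c d where defs: "a = orient C D A" "b = orient C D B" "c = orient A B C" "d = orient A B D"
  have cd: "c - d = - (a - b)" unfolding defs by (simp add: orient_def algebra_simps)
  have frac: "0 \<le> x / (x - y) \<and> x / (x - y) \<le> 1 \<and> x - y \<noteq> 0" if "x * y < 0" for x y :: real
    using that by (auto simp: mult_less_0_iff field_simps)
  have f: "0 \<le> a / (a - b)" "a / (a - b) \<le> 1" "a - b \<noteq> 0" "0 \<le> c / (c - d)" "c / (c - d) \<le> 1" "c - d \<noteq> 0"
    using frac[of a b] frac[of c d] assms by (auto simp: defs)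
  \<comment> \<open>Cramer's rule: the lines meet at parameter \<open>a / (a - b)\<close> on
    \<open>A B\<close> and \<open>c / (c - d)\<close> on \<open>C D\<close>. Opposite signs put both
    parameters into the unit interval.\<close>
  have "c *\<^sub>R D - d *\<^sub>R C = (c - d) *\<^sub>R A - a *\<^sub>R (B - A)"
    unfolding defs orient_def by (simp add: prod_eq_iff algebra_simps)
  then have "(1 / (c - d)) *\<^sub>R (c *\<^sub>R D - d *\<^sub>R C) = (1 / (c - d)) *\<^sub>R ((c - d) *\<^sub>R A - a *\<^sub>R (B - A))"
    by simp
  moreover have "(1 / (c - d)) *\<^sub>R (c *\<^sub>R D - d *\<^sub>R C) = (1 - c / (c - d)) *\<^sub>R C + (c / (c - d)) *\<^sub>R D"
    using f by (simp add: prod_eq_iff field_simps)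
  moreover have "(1 / (c - d)) *\<^sub>R ((c - d) *\<^sub>R A - a *\<^sub>R (B - A))
      = (1 - a / (a - b)) *\<^sub>R A + (a / (a - b)) *\<^sub>R B"
    using f(3) unfolding cd by (simp add: prod_eq_iff field_simps)
  ultimately have "(1 - c / (c - d)) *\<^sub>R C + (c / (c - d)) *\<^sub>R D = (1 - a / (a - b)) *\<^sub>R A + (a / (a - b)) *\<^sub>R B"
    by simp
  with f show ?thesis unfolding closed_segment_def by blast
qed

text \<open>Twice the signed area of an inscribed triangle: half the product of the chords
  \<open>2 sin\<close>, with angles doubled so that half-angles appear undivided.\<close>

lemma orient_circle:
  fixes x y z :: real
  shows "orient (cos (2 * x), sin (2 * x)) (cos (2 * y), sin (2 * y)) (cos (2 * z), sin (2 * z))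
    = 4 * sin (y - x) * sin (z - y) * sin (z - x)"
proof -
  have "orient (cos (2 * x), sin (2 * x)) (cos (2 * y), sin (2 * y)) (cos (2 * z), sin (2 * z))
      = sin (2 * y - 2 * x) + sin (2 * z - 2 * y) - sin (2 * z - 2 * x)"
    by (simp add: orient_def sin_diff algebra_simps)
  also have "\<dots> = sin (2 * (y - x)) + sin (2 * (z - y)) - sin (2 * ((y - x) + (z - y)))"
    by (simp add: algebra_simps)
  also have "\<dots> = 4 * sin (y - x) * sin (z - y) * sin ((y - x) + (z - y))"
  proof -
    have "sin (2 * s) + sin (2 * t) - sin (2 * (s + t)) = 4 * sin s * sin t * sin (s + t)" for s t :: real
    proof -
      have "sin (2 * s) + sin (2 * t) - sin (2 * (s + t))
          = sin (2 * s) * (1 - cos (2 * t)) + sin (2 * t) * (1 - cos (2 * s))"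
        by (simp add: distrib_left sin_add algebra_simps)
      also have "\<dots> = 4 * sin s * sin t * sin (s + t)"
        unfolding sin_double cos_double_sin sin_add by (simp add: power2_eq_square algebra_simps)
      finally show ?thesis .
    qed
    then show ?thesis by blast
  qed
  finally show ?thesis by simp
qed

lemma orient_dc_outer:
  "orient (dc_outer k x) (dc_outer k y) (dc_outer k z) =
    4 * sin (pi * (real y - real x) / real k) * sin (pi * (real z - real y) / real k)
      * sin (pi * (real z - real x) / real k)"
  using orient_circle[of "pi * real x / real k" "pi * real y / real k" "pi * real z / real k"]
  by (simp add: dc_outer_def diff_divide_distrib right_diff_distrib mult.assoc)

text \<open>Indices are not reduced mod \<open>k\<close>; any window of length \<open>k\<close>
  keeps all half-angles in \<open>[0, pi]\<close>. The index \<open>k\<close>, a second name of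
  \<open>p_0\<close>, is needed for the last inner point.\<close>

lemma orient_dc_outer_nonneg:
  assumes "x \<le> y" "y \<le> z" "z \<le> x + k"
  shows "orient (dc_outer k x) (dc_outer k y) (dc_outer k z) \<ge> 0"
proof (cases "k = 0")
  case False
  have "sin (pi * (real j - real i) / real k) \<ge> 0" if "i \<le> j" "j \<le> i + k" for i j
  proof (rule sin_ge_zero)
    have "pi * (real j - real i) \<le> pi * real k" using that by (intro mult_left_mono) auto
    then show "pi * (real j - real i) / real k \<le> pi" using False by (simp add: divide_le_eq)
  qed (use that in simp)
  then show ?thesis unfolding orient_dc_outer using assms by (intro mult_nonneg_nonneg) auto
qed (simp add: orient_dc_outer)

lemma orient_dc_outer_pos:
  assumes "x < y" "y < z" "z < x + k"
  shows "orient (dc_outer k x) (dc_outer k y) (dc_outer k z) > 0"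
proof -
  have "sin (pi * (real j - real i) / real k) > 0" if "i < j" "j < i + k" for i j
  proof (rule sin_gt_zero)
    have "pi * (real j - real i) < pi * real k" using that by (intro mult_strict_left_mono) auto
    then show "pi * (real j - real i) / real k < pi" using that by (simp add: divide_less_eq)
  qed (use that in simp)
  then show ?thesis unfolding orient_dc_outer using assms by (intro mult_pos_pos) auto
qed

lemma orient_dc_inner:
  "orient (dc_outer k i) (dc_inner k eps i) (dc_outer k (Suc i)) = - eps * sin (2 * pi / real k)"
proof -
  have "orient p ((1 - eps) *\<^sub>R midpoint p q) q = - eps * (fst p * snd q - snd p * fst q)" for p q
    by (simp add: orient_def midpoint_def field_simps)
  moreover have "fst (dc_outer k i) * snd (dc_outer k (Suc i)) - snd (dc_outer k i) * fst (dc_outer k (Suc i))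
      = sin (2 * pi * real (Suc i) / real k - 2 * pi * real i / real k)"
    by (simp add: dc_outer_def sin_diff)
  moreover have "2 * pi * real (Suc i) / real k - 2 * pi * real i / real k = 2 * pi / real k"
    by (simp add: diff_divide_distrib[symmetric] algebra_simps)
  ultimately show ?thesis by (simp add: dc_inner_def)
qed

section \<open>Orientations of all triples of the double circle\<close>

definition dc_vertex :: "nat \<Rightarrow> real \<Rightarrow> nat \<Rightarrow> point" where
  "dc_vertex k eps a = (if even a then dc_outer k (a div 2) else dc_inner k eps (a div 2))"

lemma double_circle_eq: "double_circle k eps = dc_vertex k eps ` {..<2 * k}"
proof -
  have "{..<2 * k} = (\<lambda>i. 2 * i) ` {..<k} \<union> (\<lambda>i. 2 * i + 1) ` {..<k}"
  proof (intro equalityI subsetI)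
    fix a assume "a \<in> {..<2 * k}"
    then have "a div 2 < k" "a = 2 * (a div 2) \<or> a = 2 * (a div 2) + 1" by auto
    then show "a \<in> (\<lambda>i. 2 * i) ` {..<k} \<union> (\<lambda>i. 2 * i + 1) ` {..<k}" by blast
  qed auto
  then show ?thesis
    by (simp only: image_Un image_image double_circle_def) (simp add: dc_vertex_def)
qed

text \<open>The triples \<open>p_i, q_i, p_(i+1)\<close> with indices sorted; for the last edge
  \<open>p_0\<close> comes first. They are collinear at \<open>eps = 0\<close> and the only ones to
  turn clockwise for small \<open>eps > 0\<close>.\<close>

definition ear_triple :: "nat \<Rightarrow> nat \<Rightarrow> nat \<Rightarrow> nat \<Rightarrow> bool" where
  "ear_triple k a b c \<longleftrightarrow>
    even a \<and> b = a + 1 \<and> c = a + 2 \<or> a = 0 \<and> b = 2 * k - 2 \<and> c = 2 * k - 1"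

lemma orient_dc_vertex_ear:
  assumes k: "k \<ge> 3" and "eps > 0" and e: "ear_triple k a b c"
  shows "orient (dc_vertex k eps a) (dc_vertex k eps b) (dc_vertex k eps c) < 0"
proof -
  have "sin (2 * pi / real k) > 0"
    using k by (intro sin_gt_zero) (auto simp: field_simps)
  then have neg: "orient (dc_outer k i) (dc_inner k eps i) (dc_outer k (Suc i)) < 0" for i
    unfolding orient_dc_inner using \<open>eps > 0\<close> by simp
  from e consider "even a" "b = a + 1" "c = a + 2" | "a = 0" "b = 2 * k - 2" "c = 2 * k - 1"
    by (auto simp: ear_triple_def)
  then show ?thesis
  proof cases
    case 1
    then show ?thesis using neg[of "a div 2"] by (simp add: dc_vertex_def)
  next
    case 2
    have "even b" "b div 2 = k - 1" "odd c" "c div 2 = k - 1" using 2 k by auto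
    moreover have "dc_outer k (Suc (k - 1)) = dc_outer k 0" using k by (simp add: dc_outer_def)
    ultimately show ?thesis
      using neg[of "k - 1"] 2 by (simp add: dc_vertex_def orient_cycle[of "dc_outer k 0"])
  qed
qed

lemma sum_corners_pos:
  fixes f :: "nat \<Rightarrow> nat \<Rightarrow> nat \<Rightarrow> real"
  assumes nonneg: "\<And>x y z. x \<in> {a, a'} \<Longrightarrow> y \<in> {b, b'} \<Longrightarrow> z \<in> {c, c'} \<Longrightarrow> f x y z \<ge> 0"
    and "x \<in> {a, a'}" "y \<in> {b, b'}" "z \<in> {c, c'}" and pos: "f x y z > 0"
  shows "f a b c + f a b c' + f a b' c + f a b' c' + f a' b c + f a' b c' + f a' b' c + f a' b' c' > 0"
proof -
  have "f a b c \<ge> 0" "f a b c' \<ge> 0" "f a b' c \<ge> 0" "f a b' c' \<ge> 0"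
    "f a' b c \<ge> 0" "f a' b c' \<ge> 0" "f a' b' c \<ge> 0" "f a' b' c' \<ge> 0"
    by (rule nonneg; simp)+
  moreover have "x = a \<or> x = a'" "y = b \<or> y = b'" "z = c \<or> z = c'" using assms by auto
  ultimately show ?thesis using pos by (elim disjE) (hypsubst, linarith)+
qed

text \<open>At \<open>eps = 0\<close> vertex \<open>a\<close> is the midpoint of the outer points
  \<open>a div 2\<close> and \<open>(a + 1) div 2\<close>, which coincide for even \<open>a\<close>.
  Orientation is affine in each point, hence the average over eight triples of outer points. None is
  negative, so one triple of distinct points in cyclic order suffices.\<close>

lemma orient_dc_vertex_0_pos:
  assumes k: "k \<ge> 3" and abc: "a < b" "b < c" "c < 2 * k" and ne: "\<not> ear_triple k a b c"
  shows "orient (dc_vertex k 0 a) (dc_vertex k 0 b) (dc_vertex k 0 c) > 0"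
proof -
  let ?l = "\<lambda>a. a div 2 :: nat" and ?u = "\<lambda>a. (a + 1) div 2 :: nat"
  let ?o = "\<lambda>x y z. orient (dc_outer k x) (dc_outer k y) (dc_outer k z)"
  have v: "dc_vertex k 0 a = midpoint (dc_outer k (?l a)) (dc_outer k (?u a))" for a
    by (auto simp: dc_vertex_def dc_inner_def elim!: oddE evenE)
  have ord: "?l a \<le> ?u a" "?u a \<le> ?l b" "?l b \<le> ?u b" "?u b \<le> ?l c" "?l c \<le> ?u c" "?u c \<le> ?l a + k"
    using abc by auto
  have nonneg: "?o x y z \<ge> 0" if "x \<in> {?l a, ?u a}" "y \<in> {?l b, ?u b}" "z \<in> {?l c, ?u c}" for x y z
  proof -
    have "?l a \<le> x" "x \<le> ?u a" "?l b \<le> y" "y \<le> ?u b" "?l c \<le> z" "z \<le> ?u c"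
      using that by auto
    with ord show ?thesis by (intro orient_dc_outer_nonneg) linarith+
  qed
  have "\<exists>x\<in>{?l a, ?u a}. \<exists>y\<in>{?l b, ?u b}. \<exists>z\<in>{?l c, ?u c}. x < y \<and> y < z \<and> z < x + k"
  proof -
    \<comment> \<open>The indices span a full turn only if \<open>c = 2 k - 1\<close> and
      \<open>a\<close> is 0 or 1; then the corners must avoid using \<open>p_0\<close> twice, as
      index 0 and as index \<open>k\<close>.\<close>
    consider (inner) "?u c < ?l a + k" | (a1) "a = 1" "c = 2 * k - 1" | (a0) "a = 0" "c = 2 * k - 1"
      using abc by linarith
    then show ?thesis
    proof cases
      case inner
      show ?thesis
      proof (cases "?l a < ?l b")
        case True
        moreover have "?l b < ?u c" using abc by linarith
        ultimately show ?thesis using inner by blast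
      next
        case False
        then have "even a" "b = a + 1" using abc by presburger+
        then have "?l a < ?u b" "?u b < ?u c" using abc ne by (auto simp: ear_triple_def)
        then show ?thesis using inner by blast
      qed
    next
      case a1
      show ?thesis
      proof (cases "b = 2")
        case True
        have "?l a < ?l b" "?l b < ?l c" "?l c < ?l a + k" using a1 k True by auto
        then show ?thesis by blast
      next
        case False
        have "?u a < ?u b" "?u b < ?u c" "?u c < ?u a + k" using a1 k False abc by auto
        then show ?thesis by blast
      qed
    next
      case a0
      show ?thesis
      proof (cases "b = 1")
        case True
        have "?l a < ?u b" "?u b < ?l c" "?l c < ?l a + k" using a0 k True by auto
        then show ?thesis by blast
      next
        case False
        have "b \<noteq> 2 * k - 2" using ne a0 by (auto simp: ear_triple_def)
        then have "?l a < ?l b" "?l b < ?l c" "?l c < ?l a + k" using a0 k False abc by auto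
        then show ?thesis by blast
      qed
    qed
  qed
  then obtain x y z where xyz: "x \<in> {?l a, ?u a}" "y \<in> {?l b, ?u b}" "z \<in> {?l c, ?u c}"
    and "x < y" "y < z" "z < x + k" by blast
  then have pos: "?o x y z > 0" by (intro orient_dc_outer_pos)
  have "orient (dc_vertex k 0 a) (dc_vertex k 0 b) (dc_vertex k 0 c) =
    (?o (?l a) (?l b) (?l c) + ?o (?l a) (?l b) (?u c) + ?o (?l a) (?u b) (?l c) + ?o (?l a) (?u b) (?u c)
    + ?o (?u a) (?l b) (?l c) + ?o (?u a) (?l b) (?u c) + ?o (?u a) (?u b) (?l c) + ?o (?u a) (?u b) (?u c)) / 8"
    unfolding v orient_midpoint by (simp add: field_simps)
  with sum_corners_pos[of "?l a" "?u a" "?l b" "?u b" "?l c" "?u c" ?o, OF nonneg xyz pos]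
  show ?thesis by (simp only: zero_less_divide_iff) simp
qed

definition dc_oriented :: "nat \<Rightarrow> real \<Rightarrow> bool" where
  "dc_oriented k eps \<longleftrightarrow> (\<forall>a b c. a < b \<longrightarrow> b < c \<longrightarrow> c < 2 * k \<longrightarrow>
    (if ear_triple k a b c then orient (dc_vertex k eps a) (dc_vertex k eps b) (dc_vertex k eps c) < 0
     else orient (dc_vertex k eps a) (dc_vertex k eps b) (dc_vertex k eps c) > 0))"

text \<open>Ear triples have their sign for every \<open>eps > 0\<close>. The others are positive at
  0, hence nearby by continuity, and there are finitely many.\<close>

lemma eventually_dc_oriented:
  assumes k: "k \<ge> 3"
  shows "eventually (dc_oriented k) (at_right 0)"
proof -
  let ?o = "\<lambda>eps (a, b, c). orient (dc_vertex k eps a) (dc_vertex k eps b) (dc_vertex k eps c)"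
  let ?P = "\<lambda>eps (a, b, c). if ear_triple k a b c then ?o eps (a, b, c) < 0 else ?o eps (a, b, c) > 0"
  define A where "A = {(a, b, c). a < b \<and> b < c \<and> c < 2 * k}"
  have "finite A" by (rule finite_subset[of _ "{..<2*k} \<times> {..<2*k} \<times> {..<2*k}"]) (auto simp: A_def)
  have cont: "continuous_on UNIV (\<lambda>eps. dc_vertex k eps a)" for a
    by (cases "even a") (auto simp: dc_vertex_def dc_inner_def intro!: continuous_intros)
  have "eventually (\<lambda>eps. ?P eps t) (at_right 0)" if tA: "t \<in> A" for t
  proof -
    obtain a b c where t: "t = (a, b, c)" "a < b" "b < c" "c < 2 * k" using tA by (auto simp: A_def)
    show ?thesis
    proof (cases "ear_triple k a b c")
      case True
      then show ?thesis using orient_dc_vertex_ear[OF k] t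
        by (auto intro: eventually_mono[OF eventually_at_right_less[of 0]])
    next
      case False
      have "continuous_on UNIV (\<lambda>eps. ?o eps t)"
        unfolding t(1) orient_def case_prod_conv by (intro continuous_intros cont)
      then have "((\<lambda>eps. ?o eps t) \<longlongrightarrow> ?o 0 t) (at_right 0)"
        by (auto simp: continuous_on_eq_continuous_within continuous_within
            intro: tendsto_mono[OF at_le])
      moreover have "?o 0 t > 0" using orient_dc_vertex_0_pos[OF k t(2-4) False] t by simp
      ultimately have "eventually (\<lambda>eps. ?o eps t > 0) (at_right 0)" by (rule order_tendstoD)
      then show ?thesis using False t by simp
    qed
  qed
  then have "eventually (\<lambda>eps. \<forall>t\<in>A. ?P eps t) (at_right 0)"
    using \<open>finite A\<close> by (intro eventually_ball_finite) auto
  then show ?thesis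
    by (rule eventually_mono) (auto simp: A_def dc_oriented_def)
qed

section \<open>From crossing segments to interleaving chords\<close>

lemma crosses_commute: "crosses e f \<longleftrightarrow> crosses f e"
  by (auto simp: crosses_def)

lemma interleave_commute: "interleave e f \<longleftrightarrow> interleave f e"
  by (auto simp: interleave_def)

lemma inj_on_dc_vertex:
  assumes k: "k \<ge> 3" and o: "dc_oriented k eps"
  shows "inj_on (dc_vertex k eps) {..<2 * k}"
proof -
  have "dc_vertex k eps a \<noteq> dc_vertex k eps b" if "a < b" "b < 2 * k" for a b
  proof -
    let ?o = "\<lambda>a b c. orient (dc_vertex k eps a) (dc_vertex k eps b) (dc_vertex k eps c)"
    have nz: "?o x y z \<noteq> 0" if "x < y" "y < z" "z < 2 * k" for x y z
      using o that unfolding dc_oriented_def by (metis less_irrefl)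
    \<comment> \<open>Among at least six indices a third one exists before, between or after;
      coinciding points would make that triple degenerate.\<close>
    consider "0 < a" | "a + 1 < b" | "b + 1 < 2 * k" using \<open>a < b\<close> k by linarith
    then show ?thesis
      using nz[of 0 a b] nz[of a "a + 1" b] nz[of a b "b + 1"] that
      by cases (auto simp: orient_degenerate)
  qed
  then show ?thesis by (auto simp: inj_on_def) (metis linorder_neqE_nat)
qed

text \<open>In convex position interleaving would decide alone. If an ear triple spoils the
  separation test for one segment of a non-interleaving pair, the test for the other segment
  succeeds. In an interleaving pair an ear triple occurs exactly when one segment is a hull edge,
  and its reversed sign puts both ends of the other segment on the same side.\<close>

lemma crosses_dc_vertex_less:
  assumes k: "k \<ge> 3" and o: "dc_oriented k eps"
    and ab: "a < b" "b < 2 * k" and cd: "c < d" "d < 2 * k" and ac: "a < c" and ne: "b \<noteq> c" "b \<noteq> d"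
  shows "crosses {dc_vertex k eps a, dc_vertex k eps b} {dc_vertex k eps c, dc_vertex k eps d} \<longleftrightarrow>
    interleave (a, b) (c, d) \<and> \<not> ear k a b \<and> \<not> ear k c d"
proof -
  let ?v = "dc_vertex k eps"
  let ?o = "\<lambda>a b c. orient (?v a) (?v b) (?v c)"
  have pos: "?o x y z > 0" if "x < y" "y < z" "z < 2 * k" "\<not> ear_triple k x y z" for x y z
    using o that unfolding dc_oriented_def by metis
  have neg: "?o x y z < 0" if "x < y" "y < z" "z < 2 * k" "ear_triple k x y z" for x y z
    using o that unfolding dc_oriented_def by metis
  have "?v ` {a, b} \<inter> ?v ` {c, d} = ?v ` ({a, b} \<inter> {c, d})"
    by (rule inj_on_image_Int[OF inj_on_dc_vertex[OF k o], symmetric]) (use ab cd in auto)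
  then have crosses: "crosses {?v a, ?v b} {?v c, ?v d} \<longleftrightarrow>
      closed_segment (?v a) (?v b) \<inter> closed_segment (?v c) (?v d) \<noteq> {}"
    using ne ac ab cd by (simp add: crosses_def segment_convex_hull)
  have no: "\<not> crosses {?v a, ?v b} {?v c, ?v d}" if "?o a b c * ?o a b d > 0 \<or> ?o c d a * ?o c d b > 0"
    using that segments_disjoint_if_orient[of "?v a" "?v b" "?v c" "?v d"]
      segments_disjoint_if_orient[of "?v c" "?v d" "?v a" "?v b"] unfolding crosses by blast
  consider (separated) "b < c" | (nested) "c < b" "d < b" | (inter) "c < b" "b < d"
    using ne by linarith
  then show ?thesis
  proof cases
    case separated
    have "?o a b c * ?o a b d > 0 \<or> ?o c d a * ?o c d b > 0"
    proof (cases "ear_triple k a b c")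
      case False
      have "\<not> ear_triple k a b d" using separated ab cd by (auto simp: ear_triple_def)
      with False pos[of a b c] pos[of a b d] separated ab cd show ?thesis by simp
    next
      case True
      have "\<not> ear_triple k a c d" "\<not> ear_triple k b c d"
        using True k separated ab cd by (auto simp: ear_triple_def)
      with pos[of a c d] pos[of b c d] separated ab cd show ?thesis
        by (simp add: orient_cycle[of "?v c" "?v d"] orient_cycle[of "?v d" _ "?v c"])
    qed
    moreover have "\<not> interleave (a, b) (c, d)" using separated ac by (simp add: interleave_def)
    ultimately show ?thesis using no by blast
  next
    case nested
    have "?o a b c * ?o a b d > 0 \<or> ?o c d a * ?o c d b > 0"
    proof (cases "ear_triple k a d b")
      case False
      have "\<not> ear_triple k a c b" using nested ab cd by (auto simp: ear_triple_def)
      with False pos[of a c b] pos[of a d b] nested ab cd ac have "?o a c b > 0" "?o a d b > 0" by auto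
      then show ?thesis
        by (simp add: orient_swap[of "?v a" "?v b"] orient_cycle[of "?v b" "?v a"])
    next
      case True
      have "\<not> ear_triple k a c d" "\<not> ear_triple k c d b"
        using True k nested ab cd ac by (auto simp: ear_triple_def) presburger+
      with pos[of a c d] pos[of c d b] nested ab cd ac show ?thesis
        by (simp add: orient_cycle[of "?v a" "?v c" "?v d"])
    qed
    moreover have "\<not> interleave (a, b) (c, d)" using nested ac by (simp add: interleave_def)
    ultimately show ?thesis using no by blast
  next
    case inter
    have il: "interleave (a, b) (c, d)" using inter ac by (simp add: interleave_def)
    have e: "?o a b c = - ?o a c b" "?o c d a = ?o a c d" "?o c d b = - ?o c b d"
      by (simp_all add: orient_def algebra_simps)
    consider (ab) "ear k a b" | (cd) "ear k c d" | (none) "\<not> ear k a b" "\<not> ear k c d" by blast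
    then show ?thesis
    proof cases
      case ab
      have "?o a b c * ?o a b d > 0"
      proof (cases "b = a + 2")
        case True
        have "ear_triple k a c b" "\<not> ear_triple k a b d"
          using True ab inter ac cd k by (auto simp: ear_def ear_triple_def)
        with neg[of a c b] pos[of a b d] inter cd ac ab show ?thesis
          unfolding e by (simp add: mult_pos_neg mult_neg_pos)
      next
        case False
        have "\<not> ear_triple k a c b" "ear_triple k a b d"
          using False ab inter ac cd k by (auto simp: ear_def ear_triple_def)
        with pos[of a c b] neg[of a b d] inter cd ac ab show ?thesis
          unfolding e by (simp add: mult_pos_neg mult_neg_pos)
      qed
      with no ab show ?thesis by blast
    next
      case cd
      have "ear_triple k c b d" "\<not> ear_triple k a c d"
        using cd inter ac \<open>d < 2 * k\<close> k by (auto simp: ear_def ear_triple_def)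
      with neg[of c b d] pos[of a c d] inter \<open>d < 2 * k\<close> ac have "?o c d a * ?o c d b > 0"
        unfolding e by (simp add: mult_pos_neg mult_neg_pos)
      with no cd show ?thesis by blast
    next
      case none
      have "\<not> ear_triple k a c b" "\<not> ear_triple k a b d" "\<not> ear_triple k a c d" "\<not> ear_triple k c b d"
        using none inter ac ab cd by (auto simp: ear_def ear_triple_def)
      with pos[of a c b] pos[of a b d] pos[of a c d] pos[of c b d] inter ac ab cd
      have "?o a c b > 0" "?o a b d > 0" "?o a c d > 0" "?o c b d > 0" by simp_all
      then have "closed_segment (?v a) (?v b) \<inter> closed_segment (?v c) (?v d) \<noteq> {}"
        by (intro segments_meet_if_orient) (simp_all add: e mult_pos_neg mult_neg_pos)
      with il none show ?thesis unfolding crosses by blast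
    qed
  qed
qed

lemma crosses_dc_vertex:
  assumes k: "k \<ge> 3" and o: "dc_oriented k eps"
    and ab: "a < b" "b < 2 * k" and cd: "c < d" "d < 2 * k"
  shows "crosses {dc_vertex k eps a, dc_vertex k eps b} {dc_vertex k eps c, dc_vertex k eps d} \<longleftrightarrow>
    interleave (a, b) (c, d) \<and> \<not> ear k a b \<and> \<not> ear k c d"
proof (cases "{a, b} \<inter> {c, d} = {}")
  case False
  then have "\<not> crosses {dc_vertex k eps a, dc_vertex k eps b} {dc_vertex k eps c, dc_vertex k eps d}"
    unfolding crosses_def by blast
  moreover have "\<not> interleave (a, b) (c, d)" using False by (auto simp: interleave_def)
  ultimately show ?thesis by blast
next
  case True
  then consider "a < c" | "c < a" by fastforce
  then show ?thesis
  proof cases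
    case 1
    then show ?thesis using crosses_dc_vertex_less[OF k o ab cd] True by blast
  next
    case 2
    then show ?thesis using crosses_dc_vertex_less[OF k o cd ab] True crosses_commute interleave_commute by blast
  qed
qed

text \<open>On index pairs, crossing is interleaving with the ears made isolated. Deleting the ears
  leaves exactly the chords of the full interval.\<close>

lemma card_triangulations_double_circle:
  assumes k: "k \<ge> 3" and o: "dc_oriented k eps"
  shows "card (triangulations (double_circle k eps)) = dissection_count k 0 (2 * k - 1)"
proof -
  define v where "v = dc_vertex k eps"
  define U where "U = {(a, b). a < b \<and> b < 2 * k}"
  define E where "E = (\<lambda>(a, b). {v a, v b})"
  define R where "R e f \<longleftrightarrow> interleave e f \<and> \<not> (case e of (a, b) \<Rightarrow> ear k a b) \<and> \<not> (case f of (a, b) \<Rightarrow> ear k a b)"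
    for e f
  define Z where "Z = {(a, b) \<in> U. ear k a b}"
  have inj: "inj_on v {..<2 * k}" unfolding v_def by (rule inj_on_dc_vertex[OF k o])
  have veq: "v x = v y \<longleftrightarrow> x = y" if "x < 2 * k" "y < 2 * k" for x y
    using inj that by (auto dest: inj_onD)
  have "inj_on E U"
    by (auto simp: inj_on_def E_def U_def doubleton_eq_iff veq)
  moreover have "segments (double_circle k eps) = E ` U"
  proof (intro equalityI subsetI)
    fix s assume "s \<in> segments (double_circle k eps)"
    then obtain x y where xy: "s = {v x, v y}" "x < 2 * k" "y < 2 * k" "v x \<noteq> v y"
      unfolding segments_def double_circle_eq v_def[symmetric] by blast
    then consider "x < y" | "y < x" by fastforce
    then show "s \<in> E ` U"
    proof cases
      case 1
      with xy show ?thesis by (intro image_eqI[of _ _ "(x, y)"]) (auto simp: E_def U_def)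
    next
      case 2
      with xy show ?thesis by (intro image_eqI[of _ _ "(y, x)"]) (auto simp: E_def U_def)
    qed
  next
    fix s assume "s \<in> E ` U"
    then obtain x y where xy: "s = {v x, v y}" "x < y" "y < 2 * k" by (auto simp: E_def U_def)
    then have "v x \<noteq> v y" using veq[of x y] by auto
    moreover have "v x \<in> v ` {..<2 * k}" "v y \<in> v ` {..<2 * k}" using xy by auto
    ultimately show "s \<in> segments (double_circle k eps)"
      unfolding segments_def double_circle_eq v_def[symmetric] xy(1) by blast
  qed
  ultimately have "card (triangulations (double_circle k eps))
      = card (maximal_independent U (\<lambda>e f. crosses (E e) (E f)))"
    by (simp add: triangulations_eq_maximal_independent card_maximal_independent_image)
  also have "maximal_independent U (\<lambda>e f. crosses (E e) (E f)) = maximal_independent U R"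
  proof (rule maximal_independent_cong)
    fix e f assume "e \<in> U" "f \<in> U"
    then show "crosses (E e) (E f) \<longleftrightarrow> R e f"
      using crosses_dc_vertex[OF k o] by (cases e; cases f) (simp add: U_def E_def R_def v_def)
  qed
  also have "card (maximal_independent U R) = card (maximal_independent (U - Z) R)"
    by (rule card_maximal_independent_Diff_isolated) (auto simp: Z_def R_def)
  also have "maximal_independent (U - Z) R = maximal_independent (U - Z) interleave"
    by (rule maximal_independent_cong) (auto simp: Z_def R_def)
  also have "U - Z = chords k 0 (2 * k - 1)" using k by (auto simp: U_def Z_def chords_def)
  finally show ?thesis using k by (simp add: dissection_count_def dissections_def ear_def)
qed

lemma num_tri_DC_eq:
  assumes k: "k \<ge> 3"
  shows "num_tri_DC k = dissection_count k 0 (2 * k - 1)"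
proof -
  let ?n = "dissection_count k 0 (2 * k - 1)"
  have ev: "eventually (\<lambda>eps. card (triangulations (double_circle k eps)) = ?n) (at_right 0)"
    using eventually_dc_oriented[OF k] by (rule eventually_mono) (rule card_triangulations_double_circle[OF k])
  show ?thesis unfolding num_tri_DC_def
  proof (rule the_equality)
    show "eventually (\<lambda>eps. card (triangulations (double_circle k eps)) = ?n) (at_right 0)" by (rule ev)
  next
    fix n assume "eventually (\<lambda>eps. card (triangulations (double_circle k eps)) = n) (at_right 0)"
    \<comment> \<open>The filter \<open>at_right 0\<close> is nontrivial, so a constant statement
      that holds eventually is true.\<close>
    with ev have "eventually (\<lambda>eps :: real. n = ?n) (at_right 0)" by eventually_elim simp
    then show "n = ?n" by simp
  qed
qed

subsection \<open>Asymptotics\<close>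

text \<open>Up to \<open>pi/3\<close> the derivative \<open>cos t - 1/2\<close> is nonnegative;
  beyond it \<open>sin t\<close> is at least \<open>sqrt 3 / 2 >= 4/5\<close>, which exceeds
  \<open>pi/4\<close>. The slope 1/2 suffices for a dominating function.\<close>

lemma half_le_sin:
  fixes t :: real
  assumes "0 \<le> t" "t \<le> pi / 2"
  shows "t / 2 \<le> sin t"
proof (cases "t \<le> pi / 3")
  case True
  have "sin 0 - 0 / 2 \<le> sin t - t / 2"
  proof (rule DERIV_nonneg_imp_nondecreasing[OF assms(1)])
    fix x assume x: "0 \<le> x" "x \<le> t"
    have "cos (pi / 3) \<le> cos x" using x True by (intro cos_monotone_0_pi_le) auto
    then have "0 \<le> cos x - 1 / 2" by (simp add: cos_60)
    moreover have "((\<lambda>x. sin x - x / 2) has_real_derivative cos x - 1 / 2) (at x)"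
      by (auto intro!: derivative_eq_intros)
    ultimately show "\<exists>y. ((\<lambda>x. sin x - x / 2) has_real_derivative y) (at x) \<and> 0 \<le> y" by blast
  qed
  then show ?thesis by simp
next
  case False
  have "4 / 5 \<le> sqrt 3 / 2" by (rule power2_le_imp_le) (auto simp: power2_eq_square)
  also have "\<dots> = sin (pi / 3)" by (simp add: sin_60)
  also have "\<dots> \<le> sin t" using False assms by (intro sin_monotone_2pi_le) auto
  finally have "4 / 5 \<le> sin t" .
  moreover have "pi < 32 / 10" using pi_approx by simp
  ultimately show ?thesis using assms(2) by linarith
qed

lemma gaussian_second_moment:
  fixes a :: real
  assumes "a > 0"
  shows "has_bochner_integral lborel (\<lambda>s. indicator {0..} s * (s\<^sup>2 * exp (- (a * s\<^sup>2))))
    (sqrt pi / (4 * a * sqrt a))"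
proof -
  let ?g = "\<lambda>x::real. indicator {0..} x *\<^sub>R (exp (-x\<^sup>2) * x ^ (2 * 1))"
  have "has_bochner_integral lborel ?g (sqrt pi / 4)"
    using gaussian_moment_even_pos[of 1] by simp
  then have "has_bochner_integral lborel (\<lambda>x. ?g (0 + sqrt a * x)) ((sqrt pi / 4) /\<^sub>R \<bar>sqrt a\<bar>)"
    using assms by (subst lborel_has_bochner_integral_real_affine_iff[symmetric]) auto
  then have "has_bochner_integral lborel (\<lambda>x. (1 / a) * ?g (0 + sqrt a * x))
      ((1 / a) * ((sqrt pi / 4) /\<^sub>R \<bar>sqrt a\<bar>))"
    by (rule has_bochner_integral_mult_right)
  moreover have "(1 / a) * ?g (0 + sqrt a * x) = indicator {0..} x * (x\<^sup>2 * exp (- (a * x\<^sup>2)))" for x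
    using assms by (auto simp: indicator_def power_mult_distrib zero_le_mult_iff)
  moreover have "(1 / a) * ((sqrt pi / 4) /\<^sub>R \<bar>sqrt a\<bar>) = sqrt pi / (4 * a * sqrt a)"
    using assms by (simp add: field_simps)
  ultimately show ?thesis by (simp only:)
qed

text \<open>The integrand of \<open>cat_moment (2 k - 2) k\<close> at \<open>t = s / sqrt k\<close>,
  with the peak size \<open>4^(k-2) 3^k\<close> divided out and a factor \<open>k\<close> to balance
  \<open>sin^2 t\<close>, which is close to \<open>s^2 / k\<close>.\<close>

definition laplace_integrand :: "nat \<Rightarrow> real \<Rightarrow> real" where
  "laplace_integrand k s = indicator {0..pi/2} (s / sqrt k) *
    (real k * (sin (s / sqrt k))\<^sup>2 * (((cos (s / sqrt k))\<^sup>2) ^ (k - 2) * ((4 * (cos (s / sqrt k))\<^sup>2 - 1) / 3) ^ k))"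

lemma laplace_integrand_tendsto:
  "(\<lambda>k. laplace_integrand k s) \<longlonglongrightarrow> indicator {0..} s * (s\<^sup>2 * exp (- (7 / 3 * s\<^sup>2)))"
proof -
  consider "s < 0" | "s = 0" | "s > 0" by linarith
  then show ?thesis
  proof cases
    case 1
    have "laplace_integrand k s = 0" if "k > 0" for k
      using 1 that by (auto simp: laplace_integrand_def indicator_def field_simps)
    then have "eventually (\<lambda>k. laplace_integrand k s = 0) at_top"
      using eventually_gt_at_top by (rule eventually_mono[rotated])
    with 1 show ?thesis by (simp add: tendsto_eventually)
  next
    case 2
    then show ?thesis by (simp add: laplace_integrand_def)
  next
    case 3
    have "(\<lambda>k::nat. s / sqrt k) \<longlonglongrightarrow> 0" by real_asymp
    then have "eventually (\<lambda>k::nat. s / sqrt k < pi / 2) at_top"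
      by (rule order_tendstoD) simp
    then have "eventually (\<lambda>k. laplace_integrand k s =
      real k * (sin (s / sqrt k))\<^sup>2 * (((cos (s / sqrt k))\<^sup>2) ^ (k - 2) * ((4 * (cos (s / sqrt k))\<^sup>2 - 1) / 3) ^ k)) at_top"
      by eventually_elim (use 3 in \<open>simp add: laplace_integrand_def\<close>)
    then have ev: "eventually (\<lambda>k.
      real k * (sin (s / sqrt k))\<^sup>2 * (((cos (s / sqrt k))\<^sup>2) ^ (k - 2) * ((4 * (cos (s / sqrt k))\<^sup>2 - 1) / 3) ^ k)
        = laplace_integrand k s) at_top"
      by eventually_elim simp
    have "(\<lambda>k::nat. real k * (sin (s / sqrt k))\<^sup>2) \<longlonglongrightarrow> s\<^sup>2"
      using 3 by (real_asymp simp: power2_eq_square)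
    moreover have "(\<lambda>k::nat. ((cos (s / sqrt k))\<^sup>2) ^ (k - 2)) \<longlonglongrightarrow> exp (- s\<^sup>2)"
      using 3 by (real_asymp simp: power2_eq_square)
    moreover have "(\<lambda>k::nat. ((4 * (cos (s / sqrt k))\<^sup>2 - 1) / 3) ^ k) \<longlonglongrightarrow> exp (- (4 / 3 * s\<^sup>2))"
      using 3 by (real_asymp simp: power2_eq_square)
    ultimately have "(\<lambda>k. laplace_integrand k s) \<longlonglongrightarrow> s\<^sup>2 * (exp (- s\<^sup>2) * exp (- (4 / 3 * s\<^sup>2)))"
      by (intro Lim_transform_eventually[OF _ ev] tendsto_mult)
    then show ?thesis using 3 by (simp add: mult_exp_exp)
  qed
qed

text \<open>The base \<open>(4 cos^2 t - 1) / 3\<close> changes sign at \<open>pi/3\<close> and is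
  bounded only by 1 in modulus. All decay is taken from
  \<open>cos^2 t <= 1 - t^2/4 <= exp (- t^2/4)\<close>.\<close>

lemma laplace_integrand_bound:
  assumes k: "k \<ge> 3"
  shows "\<bar>laplace_integrand k s\<bar> \<le> indicator {0..} s * (s\<^sup>2 * exp (- (1 / 12 * s\<^sup>2)))"
proof (cases "s / sqrt k \<in> {0..pi/2}")
  case True
  define t where "t = s / sqrt k"
  have t: "0 \<le> t" "t \<le> pi / 2" using True by (auto simp: t_def)
  have s: "s = sqrt k * t" "s\<^sup>2 = real k * t\<^sup>2" "0 \<le> s"
    using k t(1) by (auto simp: t_def power_mult_distrib zero_le_divide_iff power_divide)
  have c1: "\<bar>(4 * (cos t)\<^sup>2 - 1) / 3\<bar> \<le> 1"
  proof -
    have "\<bar>(4 * c - 1) / 3\<bar> \<le> 1" if "c \<le> 1" "0 \<le> c" for c :: real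
      using that by (auto simp: abs_le_iff)
    moreover have "(cos t)\<^sup>2 \<le> 1" by (simp add: abs_square_le_1)
    ultimately show ?thesis using zero_le_power2 by blast
  qed
  have "(sin t)\<^sup>2 \<le> t\<^sup>2" using t sin_x_le_x[of t] sin_ge_zero[of t] by (intro power_mono) auto
  then have b1: "real k * (sin t)\<^sup>2 \<le> s\<^sup>2" unfolding s(2) by (simp add: mult_left_mono)
  have "(t / 2)\<^sup>2 \<le> (sin t)\<^sup>2" using half_le_sin[OF t] t by (intro power_mono) auto
  then have "(cos t)\<^sup>2 \<le> 1 + (- (t\<^sup>2 / 4))" by (simp add: cos_squared_eq power_divide)
  also have "\<dots> \<le> exp (- (t\<^sup>2 / 4))" by (rule exp_ge_add_one_self)
  finally have "((cos t)\<^sup>2) ^ (k - 2) \<le> exp (- (t\<^sup>2 / 4)) ^ (k - 2)" by (intro power_mono) auto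
  also have "\<dots> = exp (- (real (k - 2) * (t\<^sup>2 / 4)))" by (simp add: exp_of_nat_mult[symmetric])
  \<comment> \<open>\<open>k - 2 >= k/3\<close> for \<open>k >= 3\<close> yields the constant 1/12,
    independent of \<open>k\<close>.\<close>
  also have "\<dots> \<le> exp (- (real k / 3 * (t\<^sup>2 / 4)))"
  proof -
    have "real k / 3 * (t\<^sup>2 / 4) \<le> real (k - 2) * (t\<^sup>2 / 4)"
      using k by (intro mult_right_mono) (auto simp: of_nat_diff)
    then show ?thesis by simp
  qed
  also have "\<dots> = exp (- (1 / 12 * s\<^sup>2))" by (simp add: s(2))
  finally have b2: "((cos t)\<^sup>2) ^ (k - 2) \<le> exp (- (1 / 12 * s\<^sup>2))" .
  have b3: "\<bar>((4 * (cos t)\<^sup>2 - 1) / 3) ^ k\<bar> \<le> 1"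
    unfolding power_abs using c1 by (intro power_le_one) auto
  have "\<bar>laplace_integrand k s\<bar> = real k * (sin t)\<^sup>2 * (((cos t)\<^sup>2) ^ (k - 2) * \<bar>((4 * (cos t)\<^sup>2 - 1) / 3) ^ k\<bar>)"
    unfolding laplace_integrand_def using True by (simp add: abs_mult flip: t_def)
  also have "\<dots> \<le> s\<^sup>2 * (exp (- (1 / 12 * s\<^sup>2)) * 1)"
    using b1 b2 b3 by (intro mult_mono) auto
  finally show ?thesis using s(3) by simp
qed (simp add: laplace_integrand_def)

lemma laplace_integrand_integral_tendsto:
  "(\<lambda>k. \<integral>s. laplace_integrand k s \<partial>lborel) \<longlonglongrightarrow> sqrt pi / (4 * (7 / 3) * sqrt (7 / 3))"
proof -
  let ?g = "\<lambda>a s::real. indicator {0..} s * (s\<^sup>2 * exp (- (a * s\<^sup>2)))"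
  have g: "has_bochner_integral lborel (?g a) (sqrt pi / (4 * a * sqrt a))" if "a > 0" for a
    using gaussian_second_moment[OF that] .
  have [measurable]: "laplace_integrand k \<in> borel_measurable borel" for k
    unfolding laplace_integrand_def[abs_def] by measurable
  \<comment> \<open>The shift by 3 makes the dominating bound available for every index.\<close>
  have "(\<lambda>k. \<integral>s. laplace_integrand (k + 3) s \<partial>lborel) \<longlonglongrightarrow> (\<integral>s. ?g (7 / 3) s \<partial>lborel)"
  proof (rule integral_dominated_convergence[where w = "?g (1 / 12)"])
    show "integrable lborel (?g (1 / 12))" using g[of "1 / 12"] by (simp add: has_bochner_integral_iff)
    show "AE s in lborel. (\<lambda>k. laplace_integrand (k + 3) s) \<longlonglongrightarrow> ?g (7 / 3) s"
      by (intro AE_I2 LIMSEQ_ignore_initial_segment laplace_integrand_tendsto)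
    show "AE s in lborel. norm (laplace_integrand (k + 3) s) \<le> ?g (1 / 12) s" for k
      using laplace_integrand_bound[of "k + 3"] by (intro AE_I2) simp
  qed simp_all
  moreover have "(\<integral>s. ?g (7 / 3) s \<partial>lborel) = sqrt pi / (4 * (7 / 3) * sqrt (7 / 3))"
    using g[of "7 / 3"] by (simp add: has_bochner_integral_iff)
  ultimately show ?thesis by (simp only: LIMSEQ_offset)
qed

lemma cat_moment_eq_laplace:
  assumes k: "k \<ge> 3"
  shows "cat_moment (2 * k - 2) k = 12 ^ k / (4 * pi) / (real k * sqrt k) * (\<integral>s. laplace_integrand k s \<partial>lborel)"
proof -
  define f where "f t = (4 * (cos t)\<^sup>2) ^ (k - 2) * (4 * (cos t)\<^sup>2 - 1) ^ k * (sin t)\<^sup>2" for t :: real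
  have "continuous_on {0..pi/2} f" unfolding f_def by (intro continuous_intros)
  then have "set_integrable lborel {0..pi/2} f" by (rule borel_integrable_atLeastAtMost')
  then have "integral {0..pi/2} f = (\<integral>t. indicator {0..pi/2} t * f t \<partial>lborel)"
    using set_borel_integral_eq_integral(2)[of "{0..pi/2}" f] by (simp add: set_lebesgue_integral_def)
  also have "\<dots> = 1 / sqrt k * (\<integral>s. indicator {0..pi/2} (s / sqrt k) * f (s / sqrt k) \<partial>lborel)"
    using lborel_integral_real_affine[of "1 / sqrt k" "\<lambda>t. indicator {0..pi/2} t * f t" 0] k by simp
  also have "(\<integral>s. indicator {0..pi/2} (s / sqrt k) * f (s / sqrt k) \<partial>lborel)
      = (\<integral>s. 12 ^ k / 16 / real k * laplace_integrand k s \<partial>lborel)"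
  proof (rule arg_cong[where f = "integral\<^sup>L lborel"], rule ext)
    fix s
    have "(12 :: real) ^ k = 4 ^ (k - 2 + 2) * 3 ^ k"
      using k power_mult_distrib[of "4 :: real" 3 k] by (simp only: le_add_diff_inverse2) simp
    then have "(12 :: real) ^ k / 16 = 4 ^ (k - 2) * 3 ^ k" by (simp add: power_add)
    then show "indicator {0..pi/2} (s / sqrt k) * f (s / sqrt k) = 12 ^ k / 16 / real k * laplace_integrand k s"
      using k by (simp add: f_def laplace_integrand_def power_mult_distrib power_divide)
  qed
  also have "\<dots> = 12 ^ k / 16 / real k * (\<integral>s. laplace_integrand k s \<partial>lborel)" by simp
  finally have "integral {0..pi/2} f = 1 / sqrt k * (12 ^ k / 16 / real k * (\<integral>s. laplace_integrand k s \<partial>lborel))" .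
  moreover have "cat_moment (2 * k - 2) k = 4 / pi * integral {0..pi/2} f"
  proof -
    have "2 * k - 2 - k = k - 2" using k by simp
    then show ?thesis unfolding cat_moment_def f_def by simp
  qed
  ultimately show ?thesis by (simp add: mult_ac)
qed

lemma double_circle_constant:
  "54 / (7 * sqrt pi) * (sqrt 21 * (5 - sqrt 21) / (7 - sqrt 21)\<^sup>2)
    = 36 / pi * (sqrt pi / (4 * (7 / 3) * sqrt (7 / 3)))"
proof -
  have r: "sqrt 21 * sqrt 21 = 21" by simp
  have "sqrt (7 / 3) = sqrt (21 / 9)" by simp
  also have "\<dots> = sqrt 21 / 3" by (subst real_sqrt_divide) simp
  finally have s: "sqrt (7 / 3) = sqrt 21 / 3" .
  have p: "pi = sqrt pi * sqrt pi" by simp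
  have less: "sqrt 21 < 5" by (rule real_less_lsqrt) auto
  \<comment> \<open>The square is \<open>70 - 14 sqrt 21\<close>, so the algebraic factor of the
    constant collapses to \<open>sqrt 21 / 14\<close>.\<close>
  have "(7 - sqrt 21)\<^sup>2 = 14 * (5 - sqrt 21)" by (simp add: power2_eq_square algebra_simps)
  then have "sqrt 21 * (5 - sqrt 21) / (7 - sqrt 21)\<^sup>2 = (sqrt 21 * (5 - sqrt 21)) / (14 * (5 - sqrt 21))"
    by (simp only:)
  also have "\<dots> = sqrt 21 / 14"
    by (rule mult_divide_mult_cancel_right) (use less in simp)
  finally have "sqrt 21 * (5 - sqrt 21) / (7 - sqrt 21)\<^sup>2 = sqrt 21 / 14" .
  moreover have "36 / pi * (sqrt pi / (4 * (7 / 3) * sqrt (7 / 3))) = 81 / 7 / sqrt 21 / sqrt pi"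
    unfolding s by (subst p) (simp add: field_simps)
  moreover have "54 / (7 * sqrt pi) * (sqrt 21 / 14) = 81 / 7 / sqrt 21 / sqrt pi"
    using r by (simp add: field_simps)
  ultimately show ?thesis by (simp only:)
qed

lemma cat_moment_asymp_equiv:
  "(\<lambda>k. cat_moment (2 * k - 2) k) \<sim>[at_top]
    (\<lambda>k. 54 / (7 * sqrt pi) * (sqrt 21 * (5 - sqrt 21) / (7 - sqrt 21)^2)
          * 12 ^ (k - 2) * real k powr (-3/2))"
proof -
  define c where "c = sqrt pi / (4 * (7 / 3) * sqrt (7 / 3))"
  have "c \<noteq> 0" by (simp add: c_def)
  have "(\<lambda>k. \<integral>s. laplace_integrand k s \<partial>lborel) \<sim>[at_top] (\<lambda>_. c)"
    using laplace_integrand_integral_tendsto \<open>c \<noteq> 0\<close> unfolding c_def[symmetric]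
    by (intro tendsto_imp_asymp_equiv_const) auto
  then have "(\<lambda>k. 12 ^ k / (4 * pi) / (real k * sqrt k) * (\<integral>s. laplace_integrand k s \<partial>lborel)) \<sim>[at_top]
      (\<lambda>k. 12 ^ k / (4 * pi) / (real k * sqrt k) * c)"
    by (intro asymp_equiv_intros)
  also have "\<dots> \<sim>[at_top] (\<lambda>k. 36 / pi * c * 12 ^ (k - 2) * real k powr (-3/2))"
  proof (rule asymp_equiv_refl_ev, use eventually_ge_at_top[of 3] in eventually_elim)
    case (elim k)
    \<comment> \<open>The constant 36 is \<open>144 / 4\<close>: \<open>144 = 12^2\<close> comes
      from the shifted exponent and 4 from the denominator \<open>4 pi\<close>.\<close>
    have "(12 :: real) ^ (k - 2 + 2) = 144 * 12 ^ (k - 2)" by (simp add: power_add)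
    moreover have "k - 2 + 2 = k" using elim by simp
    ultimately have "(12 :: real) ^ k = 144 * 12 ^ (k - 2)" by (simp only:)
    moreover have "real k powr (-3/2) = 1 / (real k * sqrt k)"
    proof -
      have "real k powr (-3/2) = 1 / real k powr (1 + 1/2)" by (simp add: powr_minus_divide)
      also have "real k powr (1 + 1/2) = real k * sqrt k"
        using elim by (simp only: powr_add powr_half_sqrt) simp
      finally show ?thesis .
    qed
    ultimately show ?case by simp
  qed
  finally have "(\<lambda>k. 12 ^ k / (4 * pi) / (real k * sqrt k) * (\<integral>s. laplace_integrand k s \<partial>lborel)) \<sim>[at_top]
      (\<lambda>k. 36 / pi * c * 12 ^ (k - 2) * real k powr (-3/2))" .
  moreover have "eventually (\<lambda>k. cat_moment (2 * k - 2) k =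
      12 ^ k / (4 * pi) / (real k * sqrt k) * (\<integral>s. laplace_integrand k s \<partial>lborel)) at_top"
    using eventually_ge_at_top[of 3] by eventually_elim (rule cat_moment_eq_laplace)
  ultimately show ?thesis
    unfolding double_circle_constant c_def[symmetric] by (subst asymp_equiv_cong) auto
qed

theorem theorem4p1:
  shows "(\<lambda>k. real (num_tri_DC k)) \<sim>[at_top]
    (\<lambda>k. 54 / (7 * sqrt pi) * (sqrt 21 * (5 - sqrt 21) / (7 - sqrt 21)^2)
          * 12 ^ (k - 2) * real k powr (-3/2))"
proof -
  have "eventually (\<lambda>k. real (num_tri_DC k) = cat_moment (2 * k - 2) k) at_top"
    using eventually_ge_at_top[of 3]
    by eventually_elim (simp only: num_tri_DC_eq dissection_count_double_circle)
  then have "(\<lambda>k. real (num_tri_DC k)) \<sim>[at_top] (\<lambda>k. cat_moment (2 * k - 2) k)"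
    by (rule asymp_equiv_refl_ev)
  then show ?thesis using cat_moment_asymp_equiv by (rule asymp_equiv_trans)
qed

end
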